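(* Consider the equation $$t\frac{\partial u}{\partial t}=\alpha(t,x)+\lambda(t,x)u+(\beta(t,x)+xc(t,x))\frac{\partial u}{\partial x}+R_2\Bigl(t,x,u,\frac{\partial u}{\partial x}\Bigr)\qquad(\mathrm{E})$$ where $\alpha,\lambda,\beta,c$ are continuous functions on $[0,T_0]\times D_{R_0}$, holomorphic in $x$ for each fixed $t$, and $R_2(t,x,u,v)$ is a continuous function on $\Omega=[0,T_0]\times D_{R_0}\times D_{\rho_0}\times D_{\rho_0}$, holomorphic in $(x,u,v)$ for each fixed $t$, with a Taylor expansion in $(u,v)$ of the form $R_2(t,x,u,v)=\sum_{i+j\ge2}a_{i,j}(t,x)u^iv^j$. Let $\mu(t)$ be a weight function on $(0,T_0]$ and suppose that $$\sup_{x\in D_{R_0}}|\alpha(t,x)|=O(\mu(t)),\qquad \sup_{x\in D_{R_0}}|\beta(t,x)|=O(\mu(t))\qquad(\text{as }t\to+0),$$ $$\mathrm{Re}\,c(t,x)\le0\ \text{ on }[0,T_0]\times D_{R_0},\qquad \mathrm{Re}\,\lambda(0,0)<0.$$ Let $u_0(t,x)$ be the solution of $(\mathrm{E})$ described in the context. Let $u(t,x)\in\mathscr{X}_1((0,T)\times D_R)$ be a solution of $(\mathrm{E})$ with $T>0$ and $R>0$. If $$\varlimsup_{\rho\to+0}\Bigl[\lim_{\sigma\to+0}\Bigl(\frac{1}{\rho^2}\sup_{(0,\sigma)\times D_\rho}|u(t,x)|\Bigr)\Bigr]=0,$$ then $u(t,x)=u_0(t,x)$ on $(0,T_1)\times D_{R_1}$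 for some $T_1>0$ and $R_1>0$.
   Context: Here $t\in\mathbb{R}$ and $x,u,v\in\mathbb{C}$; $D_r=\{z\in\mathbb{C}: |z|<r\}$; $T_0,R_0,\rho_0>0$ are given. A weight function on $(0,T_0]$ is a positive-valued continuous function $\mu$ on $(0,T_0]$, increasing in $t$, with $\int_0^{T_0}\frac{\mu(s)}{s}ds<\infty$. $\mathscr{X}_1((0,T)\times D_R)$ is the set of functions in $C^1((0,T)\times D_R)$ that are holomorphic in $x\in D_R$ for each fixed $t$. A solution $u\in\mathscr{X}_1((0,T)\times D_R)$ of $(\mathrm{E})$ is understood to be such that $(t,x,u(t,x),\partial u/\partial x(t,x))\in\Omega$ and $(\mathrm{E})$ holds at all points of $(0,T)\times D_R$. Set $\varphi(t)=\int_0^t\frac{\mu(s)}{s}ds$ and $W_{T,R,r}=\{(t,x)\in[0,T]\times\mathbb{C}: \varphi(t)/r+|x|<R\}$. For $W=W_{T,R,r}$, $\mathscr{X}_1(W)$ is the set of functions in $C^1(W\cap\{t>0\})\cap C^0(W)$ that are holomorphic in $x$ for each fixed $t$. The solution $u_0$: it is known (Bacani-Tahara) that under the stated hypotheses on the coefficients (including $\mathrm{Re}\,\lambda(0,0)<0$) there are $T^*>0$, $R^*>0$, $r^*>0$ such that $(\mathrm{E})$ has a unique solution $u_0\in\mathscr{X}_1(W_{T^*,R^*,r^*})$ satisfying $|u_0(t,x)|\le M\mu(t)$ and $|\frac{\partial u_0}{\partial x}(t,x)|\le M\mu(t)$ on $W_{T^*,R^*,r^*}$ for some $M>0$. Fix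 such $T^*,R^*,r^*$ and this $u_0$. *)

theory Defs
  imports "HOL-Complex_Analysis.Complex_Analysis"
begin

text \<open>
  Functions of \<open>(t, x)\<close> are curried, total functions; only their values on the
  stated domains matter.
\<close>

definition holomorphic_in_x ::
    "(real \<times> complex) set \<Rightarrow> (real \<Rightarrow> complex \<Rightarrow> complex) \<Rightarrow> bool" where
  "holomorphic_in_x S f \<longleftrightarrow> (\<forall>t. f t holomorphic_on {x. (t, x) \<in> S})"

text \<open>
  Holomorphy in three complex variables: at every point of the (open) set there is a
  complex-linear total derivative.
\<close>

definition holomorphic3_on ::
    "(complex \<Rightarrow> complex \<Rightarrow> complex \<Rightarrow> complex) \<Rightarrow> (complex \<times> complex \<times> complex) set \<Rightarrow> bool" where
  "holomorphic3_on f S \<longleftrightarrow>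
     (\<forall>p\<in>S. \<exists>a b c. ((\<lambda>(x, u, v). f x u v) has_derivative
                       (\<lambda>(h, k, l). a * h + b * k + c * l)) (at p))"

text \<open>
  \<open>C\<^sup>1\<close> is meant in the real sense, in \<open>(t, x) \<in> \<real> \<times> \<complex>\<close>. The derivative is taken
  within \<open>S\<close> because \<open>W \<inter> {t > 0}\<close> below contains boundary points with \<open>t = T\<close>, where
  it is one-sided in \<open>t\<close>; on open \<open>S\<close> this is the ordinary derivative.
\<close>

definition C1_on :: "(real \<times> complex) set \<Rightarrow> (real \<Rightarrow> complex \<Rightarrow> complex) \<Rightarrow> bool" where
  "C1_on S f \<longleftrightarrow>
     (\<exists>f' :: real \<times> complex \<Rightarrow> (real \<times> complex) \<Rightarrow>\<^sub>L complex.
        (\<forall>p\<in>S. ((\<lambda>(t, x). f t x) has_derivative blinfun_apply (f' p)) (at p within S)) \<and>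
        continuous_on S f')"

definition weight_function :: "real \<Rightarrow> (real \<Rightarrow> real) \<Rightarrow> bool" where
  "weight_function T0 \<mu> \<longleftrightarrow>
     (\<forall>t\<in>{0<..T0}. 0 < \<mu> t) \<and> continuous_on {0<..T0} \<mu> \<and> mono_on {0<..T0} \<mu> \<and>
     (\<lambda>s. \<mu> s / s) integrable_on {0..T0}"

definition phi :: "(real \<Rightarrow> real) \<Rightarrow> real \<Rightarrow> real" where
  "phi \<mu> t = integral {0..t} (\<lambda>s. \<mu> s / s)"

definition W_region :: "(real \<Rightarrow> real) \<Rightarrow> real \<Rightarrow> real \<Rightarrow> real \<Rightarrow> (real \<times> complex) set" where
  "W_region \<mu> T R r = {(t, x). t \<in> {0..T} \<and> phi \<mu> t / r + norm x < R}"

definition Omega ::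
    "real \<Rightarrow> real \<Rightarrow> real \<Rightarrow> (real \<times> complex \<times> complex \<times> complex) set" where
  "Omega T0 R0 \<rho>0 = {0..T0} \<times> ball 0 R0 \<times> ball 0 \<rho>0 \<times> ball 0 \<rho>0"

text \<open>The supremum is taken in \<^typ>\<open>ereal\<close>, so the bound includes its finiteness.\<close>

definition sup_bigo :: "real \<Rightarrow> (real \<Rightarrow> complex \<Rightarrow> complex) \<Rightarrow> (real \<Rightarrow> real) \<Rightarrow> bool" where
  "sup_bigo R0 f \<mu> \<longleftrightarrow>
     (\<exists>C. \<forall>\<^sub>F t in at_right 0. (SUP x\<in>ball 0 R0. ereal (norm (f t x))) \<le> ereal (C * \<mu> t))"

definition solves_E ::
    "real \<Rightarrow> real \<Rightarrow> real \<Rightarrow>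
     (real \<Rightarrow> complex \<Rightarrow> complex) \<Rightarrow> (real \<Rightarrow> complex \<Rightarrow> complex) \<Rightarrow>
     (real \<Rightarrow> complex \<Rightarrow> complex) \<Rightarrow> (real \<Rightarrow> complex \<Rightarrow> complex) \<Rightarrow>
     (real \<Rightarrow> complex \<Rightarrow> complex \<Rightarrow> complex \<Rightarrow> complex) \<Rightarrow>
     (real \<times> complex) set \<Rightarrow> (real \<Rightarrow> complex \<Rightarrow> complex) \<Rightarrow> bool" where
  "solves_E T0 R0 \<rho>0 \<alpha> lam \<beta> c R2 S u \<longleftrightarrow>
     (\<forall>(t, x)\<in>S.
        (t, x, u t x, deriv (u t) x) \<in> Omega T0 R0 \<rho>0 \<and>
        of_real t * vector_derivative (\<lambda>s. u s x) (at t within {s. (s, x) \<in> S}) =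
          \<alpha> t x + lam t x * u t x + (\<beta> t x + x * c t x) * deriv (u t) x
          + R2 t x (u t x) (deriv (u t) x))"

definition X1_cyl :: "real \<Rightarrow> real \<Rightarrow> (real \<Rightarrow> complex \<Rightarrow> complex) set" where
  "X1_cyl T R = {u. C1_on ({0<..<T} \<times> ball 0 R) u \<and>
                    holomorphic_in_x ({0<..<T} \<times> ball 0 R) u}"

definition X1_W :: "(real \<times> complex) set \<Rightarrow> (real \<Rightarrow> complex \<Rightarrow> complex) set" where
  "X1_W W = {u. C1_on (W \<inter> {0<..} \<times> UNIV) u \<and>
                continuous_on W (\<lambda>(t, x). u t x) \<and> holomorphic_in_x W u}"

text \<open>
  The bounds are imposed for \<open>t > 0\<close>, since \<open>\<mu>\<close> is only given on \<open>(0, T0]\<close>.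
\<close>

definition mu_bounded_solution ::
    "real \<Rightarrow> real \<Rightarrow> real \<Rightarrow>
     (real \<Rightarrow> complex \<Rightarrow> complex) \<Rightarrow> (real \<Rightarrow> complex \<Rightarrow> complex) \<Rightarrow>
     (real \<Rightarrow> complex \<Rightarrow> complex) \<Rightarrow> (real \<Rightarrow> complex \<Rightarrow> complex) \<Rightarrow>
     (real \<Rightarrow> complex \<Rightarrow> complex \<Rightarrow> complex \<Rightarrow> complex) \<Rightarrow>
     (real \<Rightarrow> real) \<Rightarrow> (real \<times> complex) set \<Rightarrow> (real \<Rightarrow> complex \<Rightarrow> complex) \<Rightarrow> bool" where
  "mu_bounded_solution T0 R0 \<rho>0 \<alpha> lam \<beta> c R2 \<mu> W w \<longleftrightarrow>
     w \<in> X1_W W \<and>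
     solves_E T0 R0 \<rho>0 \<alpha> lam \<beta> c R2 (W \<inter> {0<..} \<times> UNIV) w \<and>
     (\<exists>M>0. \<forall>(t, x)\<in>W \<inter> {0<..} \<times> UNIV.
        norm (w t x) \<le> M * \<mu> t \<and> norm (deriv (w t) x) \<le> M * \<mu> t)"

end

theory Submission
  imports Defs
begin

text \<open>
  The difference \<open>w = u - u0\<close> solves a linear transport equation
  \<open>t w_t = l w + (e + x c) w_x\<close> with \<open>Re c \<le> 0\<close>, where \<open>Re l\<close> is negative and \<open>e\<close> bounded
  by \<open>L \<mu> t\<close>, both up to an error \<open>K (|w| + |w_x|)\<close> coming from the nonlinearity. Followed
  backwards in time, the characteristics leave \<open>|x| + L \<phi>(t) < \<rho>\<close> only through that error, so
  at a speed governed by \<open>S / \<delta>\<close> when \<open>|w| \<le> S\<close> and \<open>\<delta>\<close> is the distance to the boundary.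
  During the logarithmic time in which \<open>|w|\<close> decays by a factor 4 they move by less than \<open>\<delta> / 2\<close>
  if \<open>S\<close> is small compared with \<open>\<delta>\<^sup>2\<close>; this is where \<open>u = o(\<rho>\<^sup>2)\<close> enters. Hence shrinking the
  domain by \<open>\<delta>\<close> improves the bound from \<open>S\<close> to \<open>S / 4\<close>, and iterating with
  \<open>\<delta>, \<delta> / 2, \<delta> / 4, \<dots>\<close> yields \<open>w = 0\<close> on \<open>|x| + L \<phi>(t) < \<rho> / 2\<close>.
\<close>

subsection \<open>Singular transport equations\<close>

text \<open>Characteristic curves are not constructed: at a maximum of \<open>t powr a * |w|\<close> with \<open>t > t0\<close>,
  an infinitesimal step backwards along the characteristic direction stays in the region and
  increases the function.\<close>

lemma transport_max_principle:
  fixes w :: "real \<Rightarrow> complex \<Rightarrow> complex" and r r' :: "real \<Rightarrow> real"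
  assumes t02: "0 < t0" "t0 \<le> t2"
    and r: "\<And>t. t \<in> {t0..t2} \<Longrightarrow> (r has_real_derivative r' t) (at t)"
    and eq: "\<And>t x. t \<in> {t0..t2} \<Longrightarrow> norm x \<le> r t \<Longrightarrow> \<exists>wt wx l c e.
      ((\<lambda>(t, x). w t x) has_derivative (\<lambda>(h, z). of_real h * wt + z * wx)) (at (t, x)) \<and>
      of_real t * wt = l * w t x + (e + x * c) * wx \<and>
      Re c \<le> 0 \<and> Re l < - a \<and> norm e < - t * r' t"
    and S: "\<And>x. norm x \<le> r t0 \<Longrightarrow> norm (w t0 x) \<le> S"
    and S0: "0 \<le> S"
    and x2: "norm x2 \<le> r t2"
  shows "t2 powr a * norm (w t2 x2) \<le> t0 powr a * S"
proof (rule ccontr)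
  assume less: "\<not> ?thesis"
  \<comment> \<open>\<open>Q\<close> is the region swept out by the moving ball; it is compact, so
    \<open>F\<close> attains its maximum there. If the claim fails, this maximum exceeds
    \<open>t0 powr a * S\<close>.\<close>
  define Q where "Q = {p. fst p \<in> {t0..t2} \<and> norm (snd p :: complex) \<le> r (fst p)}"
  define F where "F = (\<lambda>p. fst p powr a * norm (w (fst p) (snd p)))"
  have r_cont: "continuous_on {t0..t2} r"
    using r by (meson DERIV_isCont continuous_at_imp_continuous_on)
  obtain B where B: "\<And>t. t \<in> {t0..t2} \<Longrightarrow> r t \<le> B"
  proof -
    have "{t0..t2} \<noteq> {}" using t02 by auto
    from continuous_attains_sup[OF compact_Icc this r_cont] show ?thesis using that by blast
  qed
  have "closed (({t0..t2} \<times> UNIV) \<inter> (\<lambda>p. r (fst p) - norm (snd p :: complex)) -` {0..})"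
    by (intro continuous_closed_preimage continuous_intros continuous_on_compose2[OF r_cont])
       (auto intro!: closed_Times)
  also have "({t0..t2} \<times> UNIV) \<inter> (\<lambda>p. r (fst p) - norm (snd p :: complex)) -` {0..} = Q"
    by (auto simp: Q_def)
  finally have "closed Q" .
  moreover have "Q \<subseteq> {t0..t2} \<times> cball 0 B"
    using B by (force simp: Q_def)
  ultimately have "compact (({t0..t2} \<times> cball 0 B) \<inter> Q)" "({t0..t2} \<times> cball 0 B) \<inter> Q = Q"
    by (auto intro!: compact_Int_closed compact_Times)
  then have "compact Q" by simp
  have "continuous_on Q (\<lambda>p. w (fst p) (snd p))"
  proof (rule continuous_at_imp_continuous_on, rule ballI)
    fix p assume "p \<in> Q"
    then obtain D where "((\<lambda>(t, x). w t x) has_derivative D) (at p)"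
      using eq[of "fst p" "snd p"] by (auto simp: Q_def)
    from has_derivative_continuous[OF this] show "isCont (\<lambda>p. w (fst p) (snd p)) p"
      by (simp add: split_beta')
  qed
  then have "continuous_on Q F"
    unfolding F_def using t02 by (intro continuous_intros) (auto simp: Q_def)
  moreover have Q2: "(t2, x2) \<in> Q"
    using x2 t02 by (auto simp: Q_def)
  ultimately obtain p where p: "p \<in> Q" "\<And>q. q \<in> Q \<Longrightarrow> F q \<le> F p"
    using continuous_attains_sup[OF \<open>compact Q\<close>] by blast
  obtain t x where tx: "p = (t, x)" by fastforce
  have t: "t \<in> {t0..t2}" "norm x \<le> r t" using p tx by (auto simp: Q_def)
  have Fp: "t powr a * norm (w t x) > t0 powr a * S"
    using p(2)[OF Q2] less by (simp add: tx F_def)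
  \<comment> \<open>The maximum exceeds the initial bound, so it is attained after \<open>t0\<close>
    and at a nonzero value of \<open>w\<close>; both facts make room for the strict increase derived
    below.\<close>
  have "t \<noteq> t0"
  proof
    assume "t = t0"
    then show False
      using Fp S[of x] t mult_left_mono[of "norm (w t0 x)" S "t0 powr a"] by auto
  qed
  then have t0: "t0 < t" "0 < t" using t t02 by auto
  have w0: "w t x \<noteq> 0" using Fp mult_nonneg_nonneg[OF _ S0, of "t0 powr a"] by fastforce
  obtain wt wx l c e where D:
      "((\<lambda>(t, x). w t x) has_derivative (\<lambda>(h, z). of_real h * wt + z * wx)) (at (t, x))"
      and E: "of_real t * wt = l * w t x + (e + x * c) * wx"
      and b: "Re c \<le> 0" "Re l < - a" "norm e < - t * r' t"
    using eq[OF t] by blast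
  \<comment> \<open>After division by \<open>t\<close> the characteristics have velocity
    \<open>- v\<close>, so \<open>(t - h, x + of_real h * v)\<close> follows their tangent backwards
    in time.\<close>
  define v where "v = (e + x * c) / of_real t"
  define g where "g = (\<lambda>h. w (t - h) (x + of_real h * v))"
  have "((\<lambda>h. (t - h, x + of_real h * v)) has_derivative (\<lambda>k. (- k, of_real k * v))) (at 0)"
    by (auto intro!: derivative_eq_intros)
  then have "(g has_derivative (\<lambda>k. of_real (- k) * wt + of_real k * v * wx)) (at 0)"
    using has_derivative_compose[of _ _ 0 UNIV "\<lambda>(t, x). w t x"] D
    unfolding g_def by fastforce
  \<comment> \<open>The equation eliminates \<open>wx\<close>: along the tangent only the zero-order
    term \<open>l * w t x\<close> contributes to the derivative of \<open>g\<close> at 0.\<close>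
  moreover have "v * wx = wt - l * w t x / of_real t"
  proof -
    have "(e + x * c) * wx = of_real t * wt - l * w t x" using E by simp
    then show ?thesis using t0 by (simp add: v_def diff_divide_distrib)
  qed
  then have "of_real (- k) * wt + of_real k * v * wx = of_real k * (- l * w t x / of_real t)" for k
    unfolding mult.assoc by (simp add: right_diff_distrib)
  ultimately have g: "(g has_vector_derivative (- l * w t x / of_real t)) (at 0)"
    by (simp add: has_vector_derivative_def scaleR_conv_of_real)
  \<comment> \<open>\<open>f\<close> is the square of \<open>F\<close> along the tangent,
    differentiable through the inner product. Its slope at 0 has the sign of
    \<open>- (a + Re l)\<close>, which is positive.\<close>
  define f where "f = (\<lambda>h. ((t - h) powr a)\<^sup>2 * (g h \<bullet> g h))"
  have g0: "g 0 = w t x" by (simp add: g_def)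
  have "((\<lambda>h. g h \<bullet> g h) has_real_derivative 2 * (w t x \<bullet> (- l * w t x / of_real t))) (at 0)"
    using has_derivative_inner[OF g[unfolded has_vector_derivative_def] g[unfolded has_vector_derivative_def]]
    unfolding has_field_derivative_def
    by (rule has_derivative_eq_rhs) (auto simp: g0 inner_commute algebra_simps)
  moreover have "w t x \<bullet> (- l * w t x / of_real t) = - Re l / t * (norm (w t x))\<^sup>2"
    using t0 unfolding cmod_power2 inner_complex_def by (simp add: field_simps power2_eq_square)
  ultimately have gg: "((\<lambda>h. g h \<bullet> g h) has_real_derivative
      2 * (- Re l / t * (norm (w t x))\<^sup>2)) (at 0)" by simp
  have pw: "((\<lambda>h. (t - h) powr a) has_real_derivative - (a * t powr a / t)) (at 0)"
    using t0 DERIV_fun_powr[of "\<lambda>h. t - h" "-1" 0 a]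
    by (auto simp: powr_diff intro!: derivative_eq_intros)
  have gg0: "g 0 \<bullet> g 0 = (norm (w t x))\<^sup>2"
    by (simp add: g0 power2_norm_eq_inner)
  have fd: "(f has_real_derivative
      (- 2 * (a + Re l) * (t powr a)\<^sup>2 / t * (norm (w t x))\<^sup>2)) (at 0)"
    unfolding f_def
    by (rule DERIV_cong[OF DERIV_mult[OF DERIV_power[OF pw, of 2] gg]])
       (simp add: gg0 power2_eq_square algebra_simps add_divide_distrib diff_divide_distrib)
  have "\<exists>d>0. \<forall>h>0. h < d \<longrightarrow> f 0 < f (0 + h)"
  proof (rule DERIV_pos_inc_right[OF fd])
    have "0 < - 2 * (a + Re l)" using b by simp
    then show "0 < - 2 * (a + Re l) * (t powr a)\<^sup>2 / t * (norm (w t x))\<^sup>2"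
      by (rule mult_pos_pos[OF divide_pos_pos[OF mult_pos_pos]]) (use t0 w0 in auto)
  qed
  then obtain d where d: "d > 0" "\<And>h. 0 < h \<Longrightarrow> h < d \<Longrightarrow> f 0 < f h" by auto
  have "\<exists>d>0. \<forall>h>0. h < d \<longrightarrow> norm (x + of_real h * v) \<le> r (t - h)"
  proof -
    define c' where "c' = c / of_real t"
    \<comment> \<open>\<open>G h > 0\<close> means that \<open>r (t - h)\<close> exceeds
      \<open>r t * (1 + h\<^sup>2 * (norm c')\<^sup>2) + h * norm e / t\<close>, an upper bound for
      the norm of the displaced point. Here \<open>G 0 = 0\<close>, the term quadratic in
      \<open>h\<close> does not change the slope at 0, and the bound on \<open>e\<close> makes that
      slope positive.\<close>
    define G where "G = (\<lambda>h. r (t - h) - r t - h * (norm e / t) - r t * (h\<^sup>2 * (norm c')\<^sup>2))"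
    have rt: "((\<lambda>h. r (t - h)) has_real_derivative r' t * (- 1)) (at 0)"
      using r[OF t(1)] by (intro DERIV_chain'[of "\<lambda>h. t - h" _ 0]) (auto intro!: derivative_eq_intros)
    have "(G has_real_derivative - r' t - norm e / t) (at 0)"
        unfolding G_def using t0 by (auto intro!: derivative_eq_intros rt)
    moreover have "0 < - r' t - norm e / t" using b(3) t0 by (simp add: field_simps)
    ultimately obtain d where d: "d > 0" "\<And>h. 0 < h \<Longrightarrow> h < d \<Longrightarrow> G 0 < G h"
      using DERIV_pos_inc_right[of G "- r' t - norm e / t" 0] by auto
    have "norm (x + of_real h * v) \<le> r (t - h)" if h: "0 < h" "h < d" for h
    proof -
      have "Re c' \<le> 0" using b(1) t0 by (auto simp: c'_def divide_nonpos_pos)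
      \<comment> \<open>The linear term \<open>2 * h * Re c'\<close> is nonpositive, so
        multiplication by \<open>1 + of_real h * c'\<close> can expand only at second order.\<close>
      then have "(norm (1 + of_real h * c'))\<^sup>2 \<le> 1 + h\<^sup>2 * (norm c')\<^sup>2"
        using h unfolding cmod_power2
        by (simp add: power2_eq_square algebra_simps mult_nonneg_nonpos)
      also have "\<dots> \<le> (1 + h\<^sup>2 * (norm c')\<^sup>2)\<^sup>2"
        by (intro self_le_power) auto
      finally have "norm (1 + of_real h * c') \<le> 1 + h\<^sup>2 * (norm c')\<^sup>2"
        by (rule power2_le_imp_le) auto
      then have "norm x * norm (1 + of_real h * c') \<le> r t * (1 + h\<^sup>2 * (norm c')\<^sup>2)"
        using t by (intro mult_mono) (auto intro: order_trans[OF norm_ge_zero])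
      moreover have "x + of_real h * v = x * (1 + of_real h * c') + of_real (h / t) * e"
        using t0 by (simp add: v_def c'_def field_simps)
      then have "norm (x + of_real h * v) \<le> norm x * norm (1 + of_real h * c') + h / t * norm e"
        using norm_triangle_ineq[of "x * (1 + of_real h * c')" "of_real (h / t) * e"] h t0
        by (simp add: norm_mult norm_divide)
      moreover have "0 < G h" using d(2)[OF h] by (simp add: G_def)
      ultimately show ?thesis by (simp add: G_def algebra_simps)
    qed
    then show ?thesis using d(1) by blast
  qed
  then obtain d' where d': "d' > 0" "\<And>h. 0 < h \<Longrightarrow> h < d' \<Longrightarrow> norm (x + of_real h * v) \<le> r (t - h)"
    by auto
  define h where "h = min (min d d') (t - t0) / 2"
  have h: "0 < h" "h < d" "h < d'" "h < t - t0" using d(1) d'(1) t0 by (auto simp: h_def)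
  have "(t - h, x + of_real h * v) \<in> Q"
    using d'(2)[of h] h t by (auto simp: Q_def)
  from p(2)[OF this] have "(t - h) powr a * norm (g h) \<le> t powr a * norm (w t x)"
    by (simp add: F_def tx g_def)
  then have "((t - h) powr a * norm (g h))\<^sup>2 \<le> (t powr a * norm (w t x))\<^sup>2"
    by (intro power_mono) auto
  then have "f h \<le> f 0"
    by (simp add: f_def g0 power_mult_distrib power2_norm_eq_inner)
  with d(2)[of h] h show False by simp
qed

text \<open>The equation is demanded only where \<open>w\<close> and its derivative are at most
  \<open>\<eta>\<close>, the range in which the nonlinearity can be linearised. Half of the decay
  rate \<open>2 * a\<close> is reserved to absorb the error with factor \<open>K\<close>. The speed
  \<open>L * \<mu> t\<close> in logarithmic time is compensated by the shrinking radius
  \<open>\<rho> - L * \<phi> t\<close>.\<close>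

locale singular_transport =
  fixes w :: "real \<Rightarrow> complex \<Rightarrow> complex" and \<phi> \<mu> :: "real \<Rightarrow> real" and t1 \<rho> L K a \<eta> :: real
  assumes a: "0 < a" and K: "0 \<le> K" and \<rho>: "0 < \<rho>"
    and phi: "\<And>t. 0 < t \<Longrightarrow> t < t1 \<Longrightarrow> (\<phi> has_real_derivative \<mu> t / t) (at t)"
    and hol: "\<And>t. 0 < t \<Longrightarrow> t < t1 \<Longrightarrow> w t holomorphic_on ball 0 (\<rho> - L * \<phi> t)"
    and eq: "\<And>t x. 0 < t \<Longrightarrow> t < t1 \<Longrightarrow> norm x + L * \<phi> t < \<rho> \<Longrightarrow>
      norm (w t x) + norm (deriv (w t) x) \<le> \<eta> \<Longrightarrow> \<exists>wt l c e.
      ((\<lambda>(t, x). w t x) has_derivative (\<lambda>(h, z). of_real h * wt + z * deriv (w t) x)) (at (t, x)) \<and>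
      of_real t * wt = l * w t x + (e + x * c) * deriv (w t) x \<and> Re c \<le> 0 \<and>
      Re l \<le> - 2 * a + K * (norm (w t x) + norm (deriv (w t) x)) \<and>
      norm e < L * \<mu> t + K * (norm (w t x) + norm (deriv (w t) x))"
begin

text \<open>One half of \<open>\<delta>\<close> makes room for Cauchy discs, which bound
  \<open>w\<close> and its derivative together by \<open>N\<close>; the other half pays for the
  drift \<open>K * N * ln 4 / a\<close> of the characteristics.\<close>

lemma quarter_bound:
  assumes S: "\<And>t x. 0 < t \<Longrightarrow> t < t1 \<Longrightarrow> norm x + L * \<phi> t < R \<Longrightarrow> norm (w t x) \<le> S"
    and S0: "0 \<le> S" and R: "R \<le> \<rho>" and \<delta>: "0 < \<delta>"
    and N: "N = S + 4 * S / \<delta>" "N \<le> \<eta>" "K * N < a" "K * N * ln 4 / a \<le> \<delta> / 2"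
    and t: "0 < t" "t < t1" and x: "norm x + L * \<phi> t < R - \<delta>"
  shows "norm (w t x) \<le> S / 4"
proof -
  \<comment> \<open>Starting at this time gains exactly the factor
    \<open>(t0 / t) powr a = 1 / 4\<close>.\<close>
  define t0 where "t0 = t * exp (- (ln 4 / a))"
  \<comment> \<open>The logarithm vanishes at \<open>t0\<close> and equals \<open>ln 4 / a\<close>
    at \<open>t\<close>. Its factor is chosen so that
    \<open>- s * r' s = L * \<mu> s + K * N\<close>, the bound available for the speed.\<close>
  define r where "r = (\<lambda>s. R - \<delta> / 2 - L * \<phi> s - K * N * ln (s / t0))"
  define r' where "r' = (\<lambda>s. - (L * \<mu> s + K * N) / s)"
  have t0: "0 < t0" "t0 \<le> t" using t a by (auto simp: t0_def mult_le_cancel_left1)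
  have N0: "0 \<le> N" using N(1) S0 \<delta> by simp
  \<comment> \<open>The margin \<open>\<delta> / 2\<close> keeps closed discs of radius
    \<open>\<delta> / 4\<close> inside the region where \<open>S\<close> is a bound.\<close>
  have inside: "norm y + L * \<phi> s \<le> R - \<delta> / 2" if "s \<in> {t0..t}" "norm y \<le> r s" for s and y :: complex
  proof -
    have "0 \<le> K * N * ln (s / t0)"
      using that t0 K N0 by (intro mult_nonneg_nonneg) auto
    then show ?thesis using that by (simp add: r_def)
  qed
  have "t powr a * norm (w t x) \<le> t0 powr a * S"
  proof (rule transport_max_principle[where w = w and r = r and r' = r'])
    show "(r has_real_derivative r' s) (at s)" if "s \<in> {t0..t}" for s
    proof -
      have "0 < s" "s < t1" using that t0 t by auto
      then show ?thesis unfolding r_def r'_def using t0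
        by (auto intro!: derivative_eq_intros phi simp: field_simps)
    qed
    show "norm x \<le> r t"
    proof -
      have "ln (t / t0) = ln 4 / a" using t by (simp add: t0_def ln_div ln_mult)
      then show ?thesis using x N(4) by (simp add: r_def)
    qed
    show "norm (w t0 y) \<le> S" if "norm y \<le> r t0" for y
      using S[of t0 y] inside[of t0 y] that t0 t \<delta> by simp
    fix s and y :: complex assume s: "s \<in> {t0..t}" and y: "norm y \<le> r s"
    have s': "0 < s" "s < t1" using s t0 t by auto
    note y' = inside[OF s y]
    have sub: "cball y (\<delta> / 4) \<subseteq> ball 0 (R - L * \<phi> s)"
    proof
      fix z assume "z \<in> cball y (\<delta> / 4)"
      then show "z \<in> ball 0 (R - L * \<phi> s)"
        using norm_triangle_ineq[of y "z - y"] y' \<delta> by (simp add: dist_norm norm_minus_commute)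
    qed
    have "w s holomorphic_on ball 0 (R - L * \<phi> s)"
      using holomorphic_on_subset[OF hol[OF s']] R by (simp add: subset_ball)
    then have h: "w s holomorphic_on cball y (\<delta> / 4)" using sub holomorphic_on_subset by blast
    have "norm ((deriv ^^ 1) (w s) y) \<le> fact 1 * S / (\<delta> / 4) ^ 1"
    proof (rule Cauchy_inequality)
      show "norm (w s z) \<le> S" if "norm (y - z) = \<delta> / 4" for z
        using sub that s' by (intro S) (force simp: dist_norm subset_iff)+
    qed (use h \<delta> holomorphic_on_subset[OF h ball_subset_cball] in \<open>auto intro: holomorphic_on_imp_continuous_on\<close>)
    then have "norm (deriv (w s) y) \<le> 4 * S / \<delta>" by (simp add: mult.commute)
    moreover have "norm (w s y) \<le> S" using S[of s y] s' y' \<delta> by simp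
    ultimately have n: "norm (w s y) + norm (deriv (w s) y) \<le> N" (is "?n \<le> _") by (simp add: N(1))
    then have Kn: "K * ?n \<le> K * N" using K by (rule mult_left_mono)
    obtain wt l c e where D:
      "((\<lambda>(t, x). w t x) has_derivative (\<lambda>(h, z). of_real h * wt + z * deriv (w s) y)) (at (s, y))"
      "of_real s * wt = l * w s y + (e + y * c) * deriv (w s) y" "Re c \<le> 0"
      "Re l \<le> - 2 * a + K * ?n" "norm e < L * \<mu> s + K * ?n"
      using eq[of s y] s' y' n N(2) \<delta> R by fastforce
    have "Re l < - a" using D(4) Kn N(3) by linarith
    moreover have "norm e < - s * r' s" using D(5) Kn s' by (simp add: r'_def)
    ultimately show "\<exists>wt wx l c e.
      ((\<lambda>(t, x). w t x) has_derivative (\<lambda>(h, z). of_real h * wt + z * wx)) (at (s, y)) \<and>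
      of_real s * wt = l * w s y + (e + y * c) * wx \<and>
      Re c \<le> 0 \<and> Re l < - a \<and> norm e < - s * r' s"
      using D(1-3) by blast
  qed (use t0 S0 in auto)
  moreover have "t0 powr a = t powr a / 4"
    using t a by (simp add: t0_def exp_minus powr_divide exp_powr_real divide_inverse[symmetric])
  ultimately show ?thesis using t by (simp add: field_simps)
qed

text \<open>At each step the bound drops by a factor 4 while \<open>\<delta>\<close> is only halved,
  so the drift shrinks as fast as the room for it and smallness at the first step suffices. The
  constants 16 and \<open>\<rho> / 8\<close> are those of the first step, where
  \<open>\<delta> = \<rho> / 4\<close>.\<close>

lemma vanishes:
  assumes S: "\<And>t x. 0 < t \<Longrightarrow> t < t1 \<Longrightarrow> norm x + L * \<phi> t < \<rho> \<Longrightarrow> norm (w t x) \<le> S"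
    and S0: "0 \<le> S"
    and N: "N = S + 16 * S / \<rho>" "N \<le> \<eta>" "K * N < a" "K * N * ln 4 / a \<le> \<rho> / 8"
    and t: "0 < t" "t < t1" and x: "norm x + L * \<phi> t < \<rho> / 2"
  shows "w t x = 0"
proof -
  \<comment> \<open>The radii start at \<open>\<rho>\<close> for \<open>k = 0\<close> and decrease
    to \<open>\<rho> / 2\<close>; consecutive ones differ by \<open>\<rho> / 2 ^ (k + 2)\<close>,
    the \<open>\<delta>\<close> of that step.\<close>
  have bound: "norm (w t x) \<le> S / 4 ^ k"
    if "0 < t" "t < t1" "norm x + L * \<phi> t < \<rho> / 2 + \<rho> / 2 ^ (k + 1)" for k t x
    using that
  proof (induction k arbitrary: t x)
    case 0
    then show ?case using S by simp
  next
    case (Suc k)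
    define S' \<delta> N' where "S' = S / 4 ^ k" and "\<delta> = \<rho> / 2 ^ (k + 2)" and "N' = S' + 4 * S' / \<delta>"
    have four: "(4::real) ^ k = 2 ^ k * 2 ^ k" by (metis num_double numeral_times_numeral power_mult_distrib)
    have "S' \<le> S / 2 ^ k"
      unfolding S'_def four using S0 by (intro divide_left_mono) (auto simp: mult_le_cancel_left1)
    moreover have "4 * S' / \<delta> = 16 * S / \<rho> / 2 ^ k"
      using \<rho> by (simp add: S'_def \<delta>_def four field_simps)
    ultimately have N'N: "N' \<le> N / 2 ^ k" by (simp add: N'_def N(1) add_divide_distrib)
    have N0: "0 \<le> N" using N(1) S0 \<rho> by simp
    have N'N2: "N' \<le> N"
      using N'N N0 by (smt (verit) divide_left_mono div_by_1 one_le_power mult_pos_pos zero_less_power)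
    have "norm (w t x) \<le> S' / 4"
    proof (rule quarter_bound[where R = "\<rho> / 2 + \<rho> / 2 ^ (k + 1)" and \<delta> = \<delta> and N = N'])
      show "norm (w t x) \<le> S'" if "0 < t" "t < t1" "norm x + L * \<phi> t < \<rho> / 2 + \<rho> / 2 ^ (k + 1)" for t x
        using Suc.IH[OF that] by (simp add: S'_def)
      show "\<rho> / 2 + \<rho> / 2 ^ (k + 1) \<le> \<rho>"
        using \<rho> by (simp add: field_simps)
      show "K * N' < a" using mult_left_mono[OF N'N2 K] N(3) by simp
      have "K * N' * ln 4 / a \<le> K * (N / 2 ^ k) * ln 4 / a"
        using N'N K a by (intro divide_right_mono mult_right_mono mult_left_mono) auto
      also have "\<dots> = (K * N * ln 4 / a) / 2 ^ k" by simp
      also have "\<dots> \<le> (\<rho> / 8) / 2 ^ k" using N(4) by (intro divide_right_mono) auto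
      finally show "K * N' * ln 4 / a \<le> \<delta> / 2" by (simp add: \<delta>_def field_simps)
      show "norm x + L * \<phi> t < \<rho> / 2 + \<rho> / 2 ^ (k + 1) - \<delta>"
        using Suc.prems(3) by (simp add: \<delta>_def)
    qed (use Suc.prems S0 \<rho> N'N2 N(2) in \<open>auto simp: N'_def S'_def \<delta>_def\<close>)
    then show ?case by (simp add: S'_def field_simps)
  qed
  have "norm (w t x) \<le> 0"
  proof (rule LIMSEQ_le_const)
    show "(\<lambda>k. S / 4 ^ k) \<longlonglongrightarrow> 0"
      by (rule LIMSEQ_divide_realpow_zero) auto
    have "norm x + L * \<phi> t < \<rho> / 2 + \<rho> / 2 ^ (k + 1)" for k
      using x \<rho> by (smt (verit) zero_less_divide_iff zero_less_power)
    then show "\<exists>N. \<forall>k\<ge>N. norm (w t x) \<le> S / 4 ^ k"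
      using bound[OF t] by blast
  qed
  then show ?thesis by simp
qed

end

subsection \<open>The nonlinear term\<close>

text \<open>The power series starts at order two, and Cauchy's estimates bound its coefficients by
  \<open>N / s ^ n\<close>. Since \<open>1 / s\<close> is at most one half, the series at 1 is
  dominated by a geometric one with sum \<open>2 * N / s\<^sup>2\<close>.\<close>

lemma norm_le_of_double_zero:
  fixes h :: "complex \<Rightarrow> complex"
  assumes h: "h holomorphic_on ball 0 r" and s: "2 \<le> s" "s < r"
    and N: "\<And>z. norm z \<le> s \<Longrightarrow> norm (h z) \<le> N"
    and zero: "h 0 = 0" "deriv h 0 = 0"
  shows "norm (h 1) \<le> 2 * N / s\<^sup>2"
proof -
  define c where "c = (\<lambda>n. (deriv ^^ n) h 0 / fact n)"
  have N0: "0 \<le> N" using N[of 0] s order_trans[OF norm_ge_zero] by fastforce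
  have hs: "h holomorphic_on cball 0 s" by (rule holomorphic_on_subset[OF h]) (use s in auto)
  have c: "norm (c n) \<le> N / s ^ n" for n
  proof -
    have "norm ((deriv ^^ n) h 0) \<le> fact n * N / s ^ n"
    proof (rule Cauchy_inequality)
      show "h holomorphic_on ball 0 s" by (rule holomorphic_on_subset[OF hs]) auto
      show "continuous_on (cball 0 s) h" by (rule holomorphic_on_imp_continuous_on[OF hs])
    qed (use s N in auto)
    then show ?thesis by (simp add: c_def norm_divide field_simps)
  qed
  have c01: "c 0 = 0" "c 1 = 0" using zero by (auto simp: c_def)
  have "(\<lambda>n. c n * (1 - 0) ^ n) sums h 1"
    unfolding c_def by (rule holomorphic_power_series[OF h]) (use s in auto)
  then have "(\<lambda>n. c (n + 2)) sums h 1"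
    using sums_iff_shift[of c 2 "h 1"] c01 by (simp add: numeral_2_eq_2)
  moreover have "norm (\<Sum>n. c (n + 2)) \<le> (\<Sum>n. N / s\<^sup>2 * (1 / 2) ^ n)"
  proof (rule norm_suminf_le)
    show "norm (c (n + 2)) \<le> N / s\<^sup>2 * (1 / 2) ^ n" for n
    proof -
      have "norm (c (n + 2)) \<le> N / s\<^sup>2 * (1 / s ^ n)"
        using c[of "n + 2"] by (simp add: power_add power2_eq_square mult_ac)
      also have "\<dots> \<le> N / s\<^sup>2 * (1 / 2 ^ n)"
        using s N0 by (intro mult_left_mono divide_left_mono power_mono) auto
      finally show ?thesis by (simp add: power_divide)
    qed
    show "summable (\<lambda>n. N / s\<^sup>2 * (1 / 2) ^ n)" by (intro summable_mult summable_geometric) auto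
  qed
  moreover have "(\<Sum>n. N / s\<^sup>2 * (1 / 2) ^ n) = 2 * N / s\<^sup>2"
    by (subst suminf_mult) (auto simp: suminf_geometric summable_geometric)
  ultimately show ?thesis by (simp add: sums_iff)
qed

text \<open>Base point and direction are arbitrary, so that the same statement serves complex lines
  through the origin and the coordinate slices in either variable.\<close>

lemma holomorphic3_on_line:
  assumes f: "holomorphic3_on f S"
    and Z: "\<And>z. z \<in> Z \<Longrightarrow> (x, p0 + z * p, q0 + z * q) \<in> S"
  shows "(\<lambda>z. f x (p0 + z * p) (q0 + z * q)) holomorphic_on Z"
  unfolding holomorphic_on_def
proof
  fix z assume "z \<in> Z"
  then obtain a b c where D: "((\<lambda>(x, u, v). f x u v) has_derivative
      (\<lambda>(h, k, l). a * h + b * k + c * l)) (at (x, p0 + z * p, q0 + z * q))"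
    using f Z unfolding holomorphic3_on_def by blast
  have "((\<lambda>z. (x, p0 + z * p, q0 + z * q)) has_derivative (\<lambda>y. (0, y * p, y * q))) (at z)"
    by (auto intro!: derivative_eq_intros)
  from has_derivative_compose[OF this D]
  have "((\<lambda>z. f x (p0 + z * p) (q0 + z * q)) has_derivative (\<lambda>y. y * (b * p) + y * (c * q))) (at z)"
    by (simp add: algebra_simps)
  moreover have "(\<lambda>y. y * (b * p) + y * (c * q)) = (*) (b * p + c * q)"
    by (auto simp: algebra_simps)
  ultimately have "((\<lambda>z. f x (p0 + z * p) (q0 + z * q)) has_derivative (*) (b * p + c * q)) (at z)"
    by simp
  then show "(\<lambda>z. f x (p0 + z * p) (q0 + z * q)) field_differentiable at z within Z"
    using field_differentiable_at_within unfolding field_differentiable_def has_field_derivative_def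
    by (metis has_derivative_at_withinI)
qed

text \<open>On a complex line through the origin, the Taylor expansion starts at order two, so the
  Cauchy estimates there turn a bound for \<open>f\<close> into a quadratic one.\<close>

lemma taylor_quadratic_bound:
  fixes f :: "complex \<Rightarrow> complex \<Rightarrow> complex \<Rightarrow> complex"
  assumes f: "holomorphic3_on f (X \<times> ball 0 \<rho> \<times> ball 0 \<rho>)" and x: "x \<in> X"
    and taylor: "\<And>p q. p \<in> ball 0 \<rho> \<Longrightarrow> q \<in> ball 0 \<rho> \<Longrightarrow>
      ((\<lambda>(i, j). a i j * p ^ i * q ^ j) has_sum f x p q) {(i, j). i + j \<ge> 2}"
    and s: "0 < s" "s < \<rho>"
    and N: "\<And>p q. norm p \<le> s \<Longrightarrow> norm q \<le> s \<Longrightarrow> norm (f x p q) \<le> N"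
    and m: "norm p \<le> m" "norm q \<le> m" "m \<le> s / 2"
  shows "norm (f x p q) \<le> 2 * N / s\<^sup>2 * m\<^sup>2"
proof -
  define h where "h = (\<lambda>z. f x (z * p) (z * q))"
  let ?I = "{(i, j). i + j \<ge> (2::nat)}"
  have pq: "p \<in> ball 0 \<rho>" "q \<in> ball 0 \<rho>" using m s by auto
  \<comment> \<open>\<open>C\<close> depends on \<open>p\<close> and \<open>q\<close>. It serves
    only to show that \<open>h\<close> vanishes to second order at 0; the uniform estimate comes
    from \<open>N\<close>.\<close>
  define C where "C = (\<Sum>\<^sub>\<infinity>(i, j)\<in>?I. norm (a i j * p ^ i * q ^ j))"
  have abs: "(\<lambda>(i, j). norm (a i j * p ^ i * q ^ j)) summable_on ?I"
    if "p \<in> ball 0 \<rho>" "q \<in> ball 0 \<rho>" for p q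
    using has_sum_imp_summable[OF taylor[OF that]]
    unfolding summable_on_iff_abs_summable_on_complex by (simp add: case_prod_unfold)
  \<comment> \<open>Every monomial has total degree at least two, so for
    \<open>norm z \<le> 1\<close> it gains a factor \<open>(norm z)\<^sup>2\<close>; absolute
    convergence allows summation of these bounds.\<close>
  have hz: "norm (h z) \<le> (norm z)\<^sup>2 * C" if z: "norm z \<le> 1" for z
  proof -
    have zpq: "z * p \<in> ball 0 \<rho>" "z * q \<in> ball 0 \<rho>"
      using pq mult_right_mono[OF z, of "norm p"] mult_right_mono[OF z, of "norm q"]
      by (auto simp: norm_mult)
    have "norm (h z) \<le> (\<Sum>\<^sub>\<infinity>(i, j)\<in>?I. norm (a i j * (z * p) ^ i * (z * q) ^ j))"
      unfolding h_def using norm_infsum_bound[of "\<lambda>(i, j). a i j * (z * p) ^ i * (z * q) ^ j" ?I]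
        abs[OF zpq] infsumI[OF taylor[OF zpq]] by (simp add: case_prod_unfold)
    also have "\<dots> \<le> (\<Sum>\<^sub>\<infinity>x\<in>?I. (norm z)\<^sup>2 * (case x of (i, j) \<Rightarrow> norm (a i j * p ^ i * q ^ j)))"
    proof (rule infsum_mono)
      fix y :: "nat \<times> nat" assume "y \<in> ?I"
      then obtain i j where y: "y = (i, j)" "2 \<le> i + j" by auto
      have "norm (a i j * (z * p) ^ i * (z * q) ^ j) = norm z ^ (i + j) * norm (a i j * p ^ i * q ^ j)"
        by (simp add: norm_mult norm_power power_mult_distrib power_add)
      also have "\<dots> \<le> (norm z)\<^sup>2 * norm (a i j * p ^ i * q ^ j)"
        using z y by (intro mult_right_mono power_decreasing) auto
      finally show "(case y of (i, j) \<Rightarrow> norm (a i j * (z * p) ^ i * (z * q) ^ j))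
          \<le> (norm z)\<^sup>2 * (case y of (i, j) \<Rightarrow> norm (a i j * p ^ i * q ^ j))" by (simp add: y)
    qed (use abs[OF zpq] abs[OF pq] summable_on_cmult_right in auto)
    also have "\<dots> = (norm z)\<^sup>2 * C"
      unfolding C_def by (rule infsum_cmult_right) (use abs[OF pq] in auto)
    finally show ?thesis .
  qed
  have h0: "h 0 = 0" using hz[of 0] by simp
  show ?thesis
  proof (cases "m = 0")
    case True
    then show ?thesis using m h0 by (simp add: h_def)
  next
    case False
    then have m0: "0 < m" using m norm_ge_zero[of p] by linarith
    have in_ball: "z * y \<in> ball 0 \<rho>" if "norm y \<le> m" "norm z < \<rho> / m" for y z :: complex
    proof -
      have "norm z * norm y \<le> norm z * m" using that by (intro mult_left_mono) auto
      also have "\<dots> < \<rho>" using that m0 by (simp add: field_simps)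
      finally show ?thesis by (simp add: norm_mult)
    qed
    have "(\<lambda>z. f x (0 + z * p) (0 + z * q)) holomorphic_on ball 0 (\<rho> / m)"
      by (rule holomorphic3_on_line[OF f]) (use x m in_ball in auto)
    then have hol: "h holomorphic_on ball 0 (\<rho> / m)" by (simp add: h_def)
    have "(h has_field_derivative 0) (at 0)"
      unfolding has_field_derivative_iff h0
    proof (rule Lim_null_comparison)
      show "\<forall>\<^sub>F z in at 0. norm ((h z - 0) / (z - 0)) \<le> norm z * C"
        unfolding eventually_at
      proof (intro exI[of _ 1] conjI ballI impI)
        fix z :: complex assume z: "z \<noteq> 0 \<and> dist z 0 < 1"
        then have "norm (h z) / norm z \<le> (norm z)\<^sup>2 * C / norm z"
          by (intro divide_right_mono hz) auto
        then show "norm ((h z - 0) / (z - 0)) \<le> norm z * C"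
          using z by (simp add: norm_divide power2_eq_square)
      qed auto
      show "((\<lambda>z. norm z * C) \<longlongrightarrow> 0) (at (0::complex))"
        by (auto intro!: tendsto_eq_intros)
    qed
    \<comment> \<open>For \<open>norm z \<le> s / m\<close> both arguments of \<open>f\<close> stay
      within radius \<open>s\<close>, where \<open>N\<close> is a bound. The condition on
      \<open>m\<close> gives \<open>2 \<le> s / m\<close>, and the square of this radius produces
      the factor \<open>m\<^sup>2\<close>.\<close>
    then have "norm (h 1) \<le> 2 * N / (s / m)\<^sup>2"
    proof (intro norm_le_of_double_zero[OF hol])
      show "norm (h z) \<le> N" if "norm z \<le> s / m" for z
      proof -
        have "norm z * norm y \<le> s" if "norm y \<le> m" for y :: complex
          using mult_mono[OF \<open>norm z \<le> s / m\<close> that] s m0 by simp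
        then show ?thesis unfolding h_def using m by (intro N) (auto simp: norm_mult)
      qed
      show "2 \<le> s / m" "s / m < \<rho> / m"
        using m m0 s by (simp_all add: field_simps)
    qed (auto simp: h0 DERIV_imp_deriv)
    then show ?thesis by (simp add: h_def power_divide)
  qed
qed

text \<open>The quadratic bound at radius \<open>2 * m\<close>, with Cauchy's estimate on circles of
  radius \<open>m\<close>, makes both partial derivatives \<open>O(m)\<close>; the difference is
  then taken one variable at a time. In this form \<open>A\<close> and \<open>B\<close> become
  coefficients of a linear equation for the difference of two solutions.\<close>

lemma taylor_difference:
  fixes f :: "complex \<Rightarrow> complex \<Rightarrow> complex \<Rightarrow> complex"
  assumes f: "holomorphic3_on f (X \<times> ball 0 \<rho> \<times> ball 0 \<rho>)" and x: "x \<in> X"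
    and taylor: "\<And>p q. p \<in> ball 0 \<rho> \<Longrightarrow> q \<in> ball 0 \<rho> \<Longrightarrow>
      ((\<lambda>(i, j). a i j * p ^ i * q ^ j) has_sum f x p q) {(i, j). i + j \<ge> 2}"
    and s: "0 < s" "s < \<rho>"
    and N: "\<And>p q. norm p \<le> s \<Longrightarrow> norm q \<le> s \<Longrightarrow> norm (f x p q) \<le> N"
    and m: "norm p \<le> m" "norm q \<le> m" "norm p' \<le> m" "norm q' \<le> m" "m \<le> s / 4"
  obtains A B where "f x p q - f x p' q' = A * (p - p') + B * (q - q')"
    and "norm A \<le> 8 * N / s\<^sup>2 * m" and "norm B \<le> 8 * N / s\<^sup>2 * m"
proof -
  define K where "K = 8 * N / s\<^sup>2 * m"
  have N0: "0 \<le> N" using N[of 0 0] s order_trans[OF norm_ge_zero] by fastforce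
  have m0: "0 \<le> m" using m norm_ge_zero[of p] by linarith
  then have K0: "0 \<le> K" using N0 by (simp add: K_def)
  have lip: "norm (g p - g p') \<le> K * norm (p - p')"
    if g: "g holomorphic_on ball 0 \<rho>"
      and b: "\<And>z. norm z \<le> 2 * m \<Longrightarrow> norm (g z) \<le> 2 * N / s\<^sup>2 * (2 * m)\<^sup>2"
      and p: "norm p \<le> m" "norm p' \<le> m" for g p p'
  proof (cases "m = 0")
    case True
    then show ?thesis using p by simp
  next
    case False
    then have "0 < m" using m0 by simp
    show ?thesis
    proof (rule field_differentiable_bound[of "cball 0 m" g "deriv g"])
      fix z :: complex assume z: "z \<in> cball 0 m"
      have "z \<in> ball 0 \<rho>" using z m s by auto
      then show "(g has_field_derivative deriv g z) (at z within cball 0 m)"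
        using g holomorphic_derivI by blast
      have sub: "cball z m \<subseteq> ball 0 \<rho>"
      proof
        fix y assume "y \<in> cball z m"
        then show "y \<in> ball 0 \<rho>"
          using z norm_triangle_sub[of y z] m s by (auto simp: dist_norm norm_minus_commute)
      qed
      then have gh: "g holomorphic_on cball z m" using g holomorphic_on_subset by blast
      have "norm ((deriv ^^ 1) g z) \<le> fact 1 * (2 * N / s\<^sup>2 * (2 * m)\<^sup>2) / m ^ 1"
      proof (rule Cauchy_inequality)
        show "norm (g y) \<le> 2 * N / s\<^sup>2 * (2 * m)\<^sup>2" if "norm (z - y) = m" for y
          using that z norm_triangle_sub[of y z] by (intro b) (auto simp: norm_minus_commute)
      qed (use \<open>0 < m\<close> gh holomorphic_on_subset[OF gh ball_subset_cball] in
          \<open>auto intro: holomorphic_on_imp_continuous_on\<close>)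
      then show "norm (deriv g z) \<le> K"
        using \<open>0 < m\<close> by (simp add: K_def power2_eq_square)
    qed (use p in auto)
  qed
  have in_ball: "z \<in> ball 0 \<rho>" if "norm z \<le> m" for z :: complex using that m s by auto
  \<comment> \<open>The radius \<open>2 * m\<close> is admissible because
    \<open>m \<le> s / 4\<close>.\<close>
  note quad = taylor_quadratic_bound[OF f x taylor s N, of _ "2 * m"]
  have "norm (f x p q - f x p' q) \<le> K * norm (p - p')"
  proof (rule lip[OF _ _ m(1,3), of "\<lambda>z. f x z q"])
    show "(\<lambda>z. f x z q) holomorphic_on ball 0 \<rho>"
      using holomorphic3_on_line[OF f, of "ball 0 \<rho>" x 0 1 q 0] x in_ball m by simp
  qed (rule quad, use m m0 in auto)
  moreover have "norm (f x p' q - f x p' q') \<le> K * norm (q - q')"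
  proof (rule lip[OF _ _ m(2,4), of "\<lambda>z. f x p' z"])
    show "(\<lambda>z. f x p' z) holomorphic_on ball 0 \<rho>"
      using holomorphic3_on_line[OF f, of "ball 0 \<rho>" x p' 0 0 1] x in_ball m by simp
  qed (rule quad, use m m0 in auto)
  \<comment> \<open>The coefficient is the difference quotient, or 0 when the increment is 0, in
    which case \<open>d\<close> vanishes too.\<close>
  moreover have quot: "\<exists>A. d = A * e \<and> norm A \<le> K" if "norm d \<le> K * norm e" for d e :: complex
  proof (cases "e = 0")
    case True
    then show ?thesis using that K0 by (intro exI[of _ 0]) auto
  next
    case False
    then show ?thesis using that by (intro exI[of _ "d / e"]) (auto simp: norm_divide divide_le_eq)
  qed
  ultimately obtain A B where "f x p q - f x p' q = A * (p - p')" "norm A \<le> K"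
      "f x p' q - f x p' q' = B * (q - q')" "norm B \<le> K" by meson
  then show ?thesis using that[of A B] unfolding K_def by (metis add_diff_cancel_left' diff_add_cancel diff_add_eq)
qed

subsection \<open>Solutions, weight functions and the smallness condition\<close>

text \<open>At interior points the derivatives within \<open>S\<close> are ordinary ones. The real
  total derivative splits into its \<open>t\<close>-part and its \<open>x\<close>-part, and
  uniqueness of derivatives identifies the latter with multiplication by the complex
  derivative.\<close>

lemma C1_on_has_derivative:
  assumes C1: "C1_on S f" and hol: "holomorphic_in_x S f" and p: "(t, x) \<in> interior S"
  shows "((\<lambda>(t, x). f t x) has_derivative
    (\<lambda>(h, z). of_real h * vector_derivative (\<lambda>s. f s x) (at t within {s. (s, x) \<in> S})
      + z * deriv (f t) x)) (at (t, x))"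
    and "f t holomorphic_on {y. (t, y) \<in> interior S}"
proof -
  have sub: "interior S \<subseteq> S" by (rule interior_subset)
  obtain f' :: "real \<times> complex \<Rightarrow> (real \<times> complex) \<Rightarrow>\<^sub>L complex"
    where f': "\<forall>p\<in>S. ((\<lambda>(t, x). f t x) has_derivative blinfun_apply (f' p)) (at p within S)"
    using C1 unfolding C1_on_def by blast
  define D where "D = blinfun_apply (f' (t, x))"
  have D: "((\<lambda>(t, x). f t x) has_derivative D) (at (t, x))"
    using f'[rule_format, of "(t, x)"] p sub at_within_interior[OF p] by (auto simp: D_def)
  interpret D: bounded_linear D by (rule has_derivative_bounded_linear[OF D])
  have open_t: "open {s. (s, x) \<in> interior S}"
    using open_vimage[OF open_interior, of "\<lambda>s. (s, x)" S] by (simp add: vimage_def continuous_intros)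
  have open_x: "open {y. (t, y) \<in> interior S}"
    using open_vimage[OF open_interior, of "\<lambda>y. (t, y)" S] by (simp add: vimage_def continuous_intros)
  show hol': "f t holomorphic_on {y. (t, y) \<in> interior S}"
    by (rule holomorphic_on_subset[OF hol[unfolded holomorphic_in_x_def, rule_format]]) (use sub in auto)
  have "((\<lambda>s. (s, x)) has_derivative (\<lambda>h. (h, 0))) (at t)"
    by (auto intro!: derivative_eq_intros)
  from has_derivative_compose[OF this D]
  have "((\<lambda>s. f s x) has_derivative (\<lambda>h. D (h, 0))) (at t)" by simp
  moreover have Dh: "(\<lambda>h. D (h, 0)) = (\<lambda>h. h *\<^sub>R D (1, 0))"
    by (rule ext) (simp flip: D.scaleR)
  ultimately have "((\<lambda>s. f s x) has_vector_derivative D (1, 0)) (at t)"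
    by (simp add: has_vector_derivative_def)
  moreover have "at t within {s. (s, x) \<in> S} = at t"
    by (rule at_within_interior[OF interiorI[OF open_t]]) (use p sub in auto)
  ultimately have Dt: "vector_derivative (\<lambda>s. f s x) (at t within {s. (s, x) \<in> S}) = D (1, 0)"
    by (simp add: vector_derivative_at)
  have "((\<lambda>y. (t, y)) has_derivative (\<lambda>z. (0, z))) (at x)"
    by (auto intro!: derivative_eq_intros)
  from has_derivative_compose[OF this D]
  have "(f t has_derivative (\<lambda>z. D (0, z))) (at x)" by simp
  moreover have "(f t has_field_derivative deriv (f t) x) (at x)"
    by (rule holomorphic_derivI[OF hol' open_x]) (use p in auto)
  ultimately have Dx: "(\<lambda>z. D (0, z)) = (*) (deriv (f t) x)"
    unfolding has_field_derivative_def by (rule has_derivative_unique)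
  have eq: "D = (\<lambda>(h, z). of_real h * D (1, 0) + z * deriv (f t) x)"
  proof (rule ext, clarify)
    fix h z
    have "D (h, z) = D (h, 0) + D (0, z)" using D.add[of "(h, 0)" "(0, z)"] by simp
    also have "\<dots> = of_real h * D (1, 0) + z * deriv (f t) x"
      unfolding fun_cong[OF Dh, of h] fun_cong[OF Dx, of z] by (simp add: scaleR_conv_of_real)
    finally show "D (h, z) = of_real h * D (1, 0) + z * deriv (f t) x" .
  qed
  show "((\<lambda>(t, x). f t x) has_derivative
    (\<lambda>(h, z). of_real h * vector_derivative (\<lambda>s. f s x) (at t within {s. (s, x) \<in> S})
      + z * deriv (f t) x)) (at (t, x))"
    unfolding Dt by (rule has_derivative_eq_rhs[OF D eq])
qed

section \<open>Weight functions and their logarithmic integrals\<close>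

context
  fixes T0 :: real and \<mu> :: "real \<Rightarrow> real"
  assumes T0: "0 < T0" and weight: "weight_function T0 \<mu>"
begin

lemma weight_pos: "0 < t \<Longrightarrow> t \<le> T0 \<Longrightarrow> 0 < \<mu> t"
  using weight by (auto simp: weight_function_def)

lemma weight_integrable: "t \<le> T0 \<Longrightarrow> 0 \<le> s \<Longrightarrow> (\<lambda>s. \<mu> s / s) integrable_on {s..t}"
  using weight integrable_on_subinterval[of "\<lambda>s. \<mu> s / s" "{0..T0}" s t]
  by (auto simp: weight_function_def)

text \<open>At \<open>s = 0\<close> the quotient is 0 by the convention for division, whatever the
  value \<open>\<mu> 0\<close>.\<close>

lemma weight_div_nonneg: "0 \<le> s \<Longrightarrow> s \<le> T0 \<Longrightarrow> 0 \<le> \<mu> s / s"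
  using weight_pos[of s] by (cases "s = 0") auto

lemma phi_nonneg: "t \<le> T0 \<Longrightarrow> 0 \<le> phi \<mu> t"
  unfolding phi_def by (intro integral_nonneg weight_integrable) (auto intro: weight_div_nonneg)

lemma phi_has_derivative:
  assumes "0 < t" "t < T0"
  shows "(phi \<mu> has_real_derivative \<mu> t / t) (at t)"
proof -
  have "continuous_on {0<..<T0} (\<lambda>s. \<mu> s / s)"
    using weight by (auto simp: weight_function_def intro!: continuous_intros
      elim: continuous_on_subset)
  then have "continuous (at t) (\<lambda>s. \<mu> s / s)"
    using assms by (simp add: continuous_on_eq_continuous_at)
  then have "((\<lambda>u. integral {0..u} (\<lambda>s. \<mu> s / s)) has_vector_derivative \<mu> t / t) (at t within ({0..T0} - {}))"
    using assms by (intro integral_has_vector_derivative_continuous_at weight_integrable)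
      (auto intro: continuous_at_imp_continuous_at_within)
  moreover have "at t within ({0..T0} - {}) = at t"
    using assms by (simp add: at_within_Icc_at)
  ultimately show ?thesis
    by (simp add: has_real_derivative_iff_has_vector_derivative phi_def[abs_def])
qed

lemma phi_tendsto_0: "(phi \<mu> \<longlongrightarrow> 0) (at_right 0)"
proof -
  have "continuous_on {0..T0} (phi \<mu>)"
    unfolding phi_def using weight_integrable[of T0 0] by (intro indefinite_integral_continuous_1) auto
  then have "(phi \<mu> \<longlongrightarrow> phi \<mu> 0) (at 0 within {0..T0})"
    using T0 by (auto simp: continuous_on_def)
  moreover have "at 0 within {0..T0} = at_right 0"
    using T0 by (rule at_within_Icc_at_right)
  ultimately show ?thesis by (simp add: phi_def)
qed

text \<open>By monotonicity the integrand is at least \<open>\<mu> t / (2 * t)\<close> on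
  \<open>{t..2 * t}\<close>, an interval of length \<open>t\<close>. This is how integrability of
  \<open>\<mu> s / s\<close> forces \<open>\<mu>\<close> to tend to 0.\<close>

lemma weight_le_phi:
  assumes "0 < t" "2 * t \<le> T0"
  shows "\<mu> t \<le> 2 * phi \<mu> (2 * t)"
proof -
  have "\<mu> t / 2 = integral {t..2 * t} (\<lambda>s. \<mu> t / (2 * t))"
    using assms by simp
  also have "\<dots> \<le> integral {t..2 * t} (\<lambda>s. \<mu> s / s)"
  proof (rule integral_le)
    fix s assume s: "s \<in> {t..2 * t}"
    then have "\<mu> t \<le> \<mu> s"
      using weight assms by (auto simp: weight_function_def mono_on_def)
    then show "\<mu> t / (2 * t) \<le> \<mu> s / s"
      using s assms weight_pos[of t] by (intro frac_le) auto
  qed (use assms weight_integrable in auto)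
  also have "\<dots> \<le> phi \<mu> (2 * t)"
    unfolding phi_def using assms weight_div_nonneg
    by (intro integral_subset_le weight_integrable) auto
  finally show ?thesis by simp
qed

lemma weight_tendsto_0: "(\<mu> \<longlongrightarrow> 0) (at_right 0)"
proof (rule tendsto_sandwich)
  have small: "\<forall>\<^sub>F t in at_right 0. 0 < t \<and> 2 * t \<le> T0"
    using T0 by (auto simp: eventually_at_right_field intro!: exI[of _ "T0 / 2"])
  show "\<forall>\<^sub>F t in at_right 0. 0 \<le> \<mu> t"
    using small by eventually_elim (use weight_pos in \<open>auto intro: less_imp_le\<close>)
  show "\<forall>\<^sub>F t in at_right 0. \<mu> t \<le> 2 * phi \<mu> (2 * t)"
    using small by eventually_elim (use weight_le_phi in auto)
  have "filterlim (\<lambda>t. 2 * t) (at_right 0) (at_right (0::real))"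
    using filterlim_times_pos[of "\<lambda>t. t" 0 "at_right (0::real)" 2 0] by (simp add: filterlim_ident)
  from filterlim_compose[OF phi_tendsto_0 this]
  show "((\<lambda>t. 2 * phi \<mu> (2 * t)) \<longlongrightarrow> 0) (at_right 0)"
    by (auto intro!: tendsto_eq_intros)
qed auto

end

text \<open>\<open>Lim\<close> is meaningful only when the limit exists, which monotonicity
  guarantees. As an infimum, the limit can be brought below a threshold by a single
  argument.\<close>

lemma Lim_at_right_mono:
  fixes g :: "real \<Rightarrow> ereal"
  assumes mono: "\<And>s t. 0 < s \<Longrightarrow> s \<le> t \<Longrightarrow> g s \<le> g t"
  shows "Lim (at_right 0) g = (INF s\<in>{0<..}. g s)"
proof (rule tendsto_Lim)
  show "(g \<longlongrightarrow> (INF s\<in>{0<..}. g s)) (at_right 0)"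
  proof (rule order_tendstoI)
    fix c assume c: "c < (INF s\<in>{0<..}. g s)"
    have "c < g s" if "0 < s" for s
      by (rule less_le_trans[OF c INF_lower]) (use that in auto)
    then show "\<forall>\<^sub>F s in at_right 0. c < g s"
      by (auto simp: eventually_at_right_field intro!: exI[of _ 1])
  next
    fix c assume "(INF s\<in>{0<..}. g s) < c"
    then obtain s where "0 < s" "g s < c" by (auto simp: INF_less_iff)
    then show "\<forall>\<^sub>F s in at_right 0. g s < c"
      unfolding eventually_at_right_field
      by (meson le_less_trans less_imp_le mono)
  qed
qed simp

text \<open>The supremum over \<open>(0, \<sigma>)\<close> grows with \<open>\<sigma>\<close>, so
  the inner limit is an infimum, and its being less than \<open>\<epsilon>\<close> already yields
  one suitable \<open>\<sigma>\<close>.\<close>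

lemma limsup_imp_quadratic_smallness:
  fixes u :: "real \<Rightarrow> complex \<Rightarrow> complex"
  assumes lim: "Limsup (at_right 0) (\<lambda>\<rho>. Lim (at_right 0) (\<lambda>\<sigma>.
          ereal (1 / \<rho>\<^sup>2) * (SUP (t, x)\<in>{0<..<\<sigma>} \<times> ball 0 \<rho>. ereal (norm (u t x))))) = 0"
    and \<epsilon>: "0 < \<epsilon>"
  shows "\<forall>\<^sub>F \<rho> in at_right 0. \<exists>\<sigma>>0. \<forall>t\<in>{0<..<\<sigma>}. \<forall>x\<in>ball 0 \<rho>. norm (u t x) \<le> \<epsilon> * \<rho>\<^sup>2"
proof -
  let ?s = "\<lambda>\<rho> \<sigma>. SUP (t, x)\<in>{0<..<\<sigma>} \<times> ball 0 \<rho>. ereal (norm (u t x))"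
  have "\<forall>\<^sub>F \<rho> in at_right 0. Lim (at_right 0) (\<lambda>\<sigma>. ereal (1 / \<rho>\<^sup>2) * ?s \<rho> \<sigma>) < ereal \<epsilon>"
    by (rule Limsup_lessD) (use lim \<epsilon> in simp)
  moreover have "\<forall>\<^sub>F \<rho>::real in at_right 0. 0 < \<rho>" by (rule eventually_at_right_less)
  ultimately show ?thesis
  proof eventually_elim
    case (elim \<rho>)
    have "Lim (at_right 0) (\<lambda>\<sigma>. ereal (1 / \<rho>\<^sup>2) * ?s \<rho> \<sigma>) = (INF \<sigma>\<in>{0<..}. ereal (1 / \<rho>\<^sup>2) * ?s \<rho> \<sigma>)"
      by (intro Lim_at_right_mono ereal_mult_left_mono SUP_subset_mono) auto
    with elim obtain \<sigma> where \<sigma>: "0 < \<sigma>" "ereal (1 / \<rho>\<^sup>2) * ?s \<rho> \<sigma> < ereal \<epsilon>"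
      by (auto simp: INF_less_iff)
    have "norm (u t x) \<le> \<epsilon> * \<rho>\<^sup>2" if "t \<in> {0<..<\<sigma>}" "x \<in> ball 0 \<rho>" for t x
    proof -
      have "ereal (norm (u t x)) \<le> ?s \<rho> \<sigma>"
        by (rule SUP_upper2[of "(t, x)"]) (use that in auto)
      then have "ereal (1 / \<rho>\<^sup>2) * ereal (norm (u t x)) \<le> ereal (1 / \<rho>\<^sup>2) * ?s \<rho> \<sigma>"
        by (intro ereal_mult_left_mono) auto
      also note \<sigma>(2)
      finally show ?thesis using elim by (simp add: field_simps)
    qed
    then show ?case using \<sigma>(1) by blast
  qed
qed

subsection \<open>Uniqueness\<close>

theorem theorem3p2:
  fixes T0 R0 \<rho>0 Ts Rs rs T R :: real
    and \<alpha> lam \<beta> c u0 u :: "real \<Rightarrow> complex \<Rightarrow> complex"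
    and R2 :: "real \<Rightarrow> complex \<Rightarrow> complex \<Rightarrow> complex \<Rightarrow> complex"
    and a :: "nat \<Rightarrow> nat \<Rightarrow> real \<Rightarrow> complex \<Rightarrow> complex"
    and \<mu> :: "real \<Rightarrow> real"
  assumes "T0 > 0" "R0 > 0" "\<rho>0 > 0"
    and coeffs: "\<And>f. f \<in> {\<alpha>, lam, \<beta>, c} \<Longrightarrow>
          continuous_on ({0..T0} \<times> ball 0 R0) (\<lambda>(t, x). f t x) \<and>
          holomorphic_in_x ({0..T0} \<times> ball 0 R0) f"
    and R2_cont: "continuous_on (Omega T0 R0 \<rho>0) (\<lambda>(t, x, p, q). R2 t x p q)"
    and R2_hol: "\<And>t. t \<in> {0..T0} \<Longrightarrow>
          holomorphic3_on (R2 t) (ball 0 R0 \<times> ball 0 \<rho>0 \<times> ball 0 \<rho>0)"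
    and R2_taylor: "\<And>t x p q. (t, x, p, q) \<in> Omega T0 R0 \<rho>0 \<Longrightarrow>
          ((\<lambda>(i, j). a i j t x * p ^ i * q ^ j) has_sum R2 t x p q) {(i, j). i + j \<ge> 2}"
    and weight: "weight_function T0 \<mu>"
    and alpha_O: "sup_bigo R0 \<alpha> \<mu>"
    and beta_O: "sup_bigo R0 \<beta> \<mu>"
    and Re_c: "\<And>t x. t \<in> {0..T0} \<Longrightarrow> x \<in> ball 0 R0 \<Longrightarrow> Re (c t x) \<le> 0"
    and Re_lam: "Re (lam 0 0) < 0"
    and "Ts > 0" "Ts \<le> T0" "Rs > 0" "rs > 0"
    and u0: "mu_bounded_solution T0 R0 \<rho>0 \<alpha> lam \<beta> c R2 \<mu> (W_region \<mu> Ts Rs rs) u0"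
    and u0_unique: "\<And>w. mu_bounded_solution T0 R0 \<rho>0 \<alpha> lam \<beta> c R2 \<mu> (W_region \<mu> Ts Rs rs) w \<Longrightarrow>
          (\<forall>(t, x)\<in>W_region \<mu> Ts Rs rs. w t x = u0 t x)"
    and "T > 0" "R > 0"
    and u_X1: "u \<in> X1_cyl T R"
    and u_sol: "solves_E T0 R0 \<rho>0 \<alpha> lam \<beta> c R2 ({0<..<T} \<times> ball 0 R) u"
    and u_limsup: "Limsup (at_right 0) (\<lambda>\<rho>. Lim (at_right 0) (\<lambda>\<sigma>.
          ereal (1 / \<rho>\<^sup>2) * (SUP (t, x)\<in>{0<..<\<sigma>} \<times> ball 0 \<rho>. ereal (norm (u t x))))) = 0"
  shows "\<exists>T1>0. \<exists>R1>0.
           {0<..<T1} \<times> ball 0 R1 \<subseteq> ({0<..<T} \<times> ball 0 R) \<inter> W_region \<mu> Ts Rs rs \<and>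
           (\<forall>t\<in>{0<..<T1}. \<forall>x\<in>ball 0 R1. u t x = u0 t x)"
proof -

  \<comment> \<open>Bounds on the coefficients and choice of constants\<close>
  define s where "s = \<rho>0 / 2"
  have s: "0 < s" "s < \<rho>0" using \<open>\<rho>0 > 0\<close> by (auto simp: s_def)
  have "compact ({0..T0} \<times> cball (0::complex) (R0 / 2) \<times> cball (0::complex) s \<times> cball (0::complex) s)" (is "compact ?C")
    by (intro compact_Times) auto
  moreover have "?C \<subseteq> Omega T0 R0 \<rho>0"
    using s \<open>R0 > 0\<close> by (auto simp: Omega_def)
  ultimately have "bounded ((\<lambda>(t, x, p, q). R2 t x p q) ` ?C)"
    using compact_continuous_image[OF continuous_on_subset[OF R2_cont]] compact_imp_bounded by blast
  then obtain N where "\<forall>y\<in>(\<lambda>(t, x, p, q). R2 t x p q) ` ?C. norm y \<le> N" and "0 < N"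
    using bounded_pos by blast
  then have N: "norm (R2 t x p q) \<le> N"
    if "t \<in> {0..T0}" "norm x \<le> R0 / 2" "norm p \<le> s" "norm q \<le> s" for t x p q
    using that by force
  \<comment> \<open>The constant of \<open>taylor_difference\<close>: coefficients of the linearised
    nonlinearity are bounded by \<open>K * m\<close>.\<close>
  define K where "K = 8 * N / s\<^sup>2"
  have K: "0 < K" using \<open>0 < N\<close> s by (simp add: K_def)
  obtain M where M: "0 < M" and u0_bound: "\<And>t x. (t, x) \<in> W_region \<mu> Ts Rs rs \<Longrightarrow> 0 < t \<Longrightarrow>
      norm (u0 t x) \<le> M * \<mu> t \<and> norm (deriv (u0 t) x) \<le> M * \<mu> t"
    using u0 unfolding mu_bounded_solution_def by fastforce
  \<comment> \<open>The decay is cut into quarters: one covers the variation of \<open>lam\<close>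
    near the origin, one the contribution of \<open>u0\<close> to the linearised term, and
    \<open>2 * \<kappa>\<close> remains as the rate \<open>2 * a\<close> of the transport
    estimate.\<close>
  define \<kappa> where "\<kappa> = - Re (lam 0 0) / 4"
  have \<kappa>: "0 < \<kappa>" using Re_lam by (simp add: \<kappa>_def)
  obtain d where d: "0 < d" and lam_bound:
    "\<And>t x. t \<in> {0..T0} \<Longrightarrow> x \<in> ball 0 R0 \<Longrightarrow> t < d \<Longrightarrow> norm x < d \<Longrightarrow> Re (lam t x) \<le> - 3 * \<kappa>"
  proof -
    have "continuous_on ({0..T0} \<times> ball 0 R0) (\<lambda>(t, x). lam t x)" using coeffs[of lam] by simp
    then obtain d where d: "0 < d" "\<And>p. p \<in> {0..T0} \<times> ball 0 R0 \<Longrightarrow> dist p (0, 0) < d \<Longrightarrow>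
        dist (case p of (t, x) \<Rightarrow> lam t x) (lam 0 0) < \<kappa>"
      unfolding continuous_on_iff using \<open>T0 > 0\<close> \<open>R0 > 0\<close> \<kappa> by fastforce
    show ?thesis
    proof (rule that[of "d / 2"])
      fix t and x :: complex assume tx: "t \<in> {0..T0}" "x \<in> ball 0 R0" "t < d / 2" "norm x < d / 2"
      have "dist (t, x) (0, 0) \<le> \<bar>t\<bar> + norm x"
        using sqrt_sum_squares_le_sum_abs[of "\<bar>t\<bar>" "norm x"] by (simp add: dist_norm norm_Pair)
      then have "dist (lam t x) (lam 0 0) < \<kappa>" using d(2)[of "(t, x)"] tx by auto
      then show "Re (lam t x) \<le> - 3 * \<kappa>"
        using abs_Re_le_cmod[of "lam t x - lam 0 0"] by (simp add: dist_norm \<kappa>_def)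
    qed (use d in simp)
  qed
  obtain C0 where C0: "\<forall>\<^sub>F t in at_right 0. \<forall>x\<in>ball 0 R0. norm (\<beta> t x) \<le> C0 * \<mu> t"
  proof -
    obtain C0 where "\<forall>\<^sub>F t in at_right 0. (SUP x\<in>ball 0 R0. ereal (norm (\<beta> t x))) \<le> ereal (C0 * \<mu> t)"
      using beta_O unfolding sup_bigo_def by blast
    then have "\<forall>\<^sub>F t in at_right 0. \<forall>x\<in>ball 0 R0. norm (\<beta> t x) \<le> C0 * \<mu> t"
      by eventually_elim (simp add: SUP_le_iff)
    then show ?thesis using that by blast
  qed
  \<comment> \<open>The summands account for \<open>\<beta>\<close>, for the contribution of
    \<open>u0\<close> through the nonlinearity, and for strictness of the bound on
    \<open>e\<close>.\<close>
  define L where "L = \<bar>C0\<bar> + K * M + 1"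
  have L: "0 < L" using K M by (simp add: L_def add_nonneg_pos)
  \<comment> \<open>\<open>s / 8\<close> is half of the radius \<open>s / 4\<close> allowed in
    \<open>taylor_difference\<close>; the other half is left to \<open>u0\<close>. The denominator
    \<open>K + 1\<close> makes \<open>K * \<eta> < \<kappa>\<close> strict.\<close>
  define \<eta> where "\<eta> = min (s / 8) (\<kappa> / (K + 1))"
  have \<eta>: "0 < \<eta>" "\<eta> \<le> s / 8" "K * \<eta> < \<kappa>"
  proof -
    show "0 < \<eta>" using s \<kappa> K by (simp add: \<eta>_def)
    show "\<eta> \<le> s / 8" unfolding \<eta>_def by (rule min.cobounded1)
    have "K * \<eta> \<le> K * (\<kappa> / (K + 1))" using K by (intro mult_left_mono) (auto simp: \<eta>_def)
    also have "\<dots> < \<kappa>" using K \<kappa> by (simp add: field_simps)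
    finally show "K * \<eta> < \<kappa>" .
  qed
  \<comment> \<open>For \<open>S = \<epsilon> * \<rho>\<^sup>2\<close> and \<open>\<rho> < 1\<close>
    the quantity \<open>S + 16 * S / \<rho>\<close> is at most
    \<open>17 * \<epsilon> * \<rho>\<close>; the factor \<open>136 = 17 * 8\<close> fits the drift
    condition with \<open>\<rho> / 8\<close>.\<close>
  define \<epsilon> where "\<epsilon> = min (\<eta> / 17) (\<kappa> / (136 * K * ln 4))"
  have \<epsilon>: "0 < \<epsilon>" "17 * \<epsilon> \<le> \<eta>" "136 * K * ln 4 * \<epsilon> \<le> \<kappa>"
  proof -
    show "0 < \<epsilon>" "17 * \<epsilon> \<le> \<eta>" using \<eta> \<kappa> K by (auto simp: \<epsilon>_def)
    have "\<epsilon> \<le> \<kappa> / (136 * K * ln 4)" by (simp add: \<epsilon>_def)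
    then show "136 * K * ln 4 * \<epsilon> \<le> \<kappa>" using K by (simp add: pos_le_divide_eq mult.commute)
  qed

  \<comment> \<open>Choice of the radius\<close>
  have "\<forall>\<^sub>F \<rho> in at_right 0. \<rho> < Min {1, R, R0 / 2, d, Rs / 2}"
    by (rule eventually_mono[OF eventually_at_right_real[of 0 "Min {1, R, R0 / 2, d, Rs / 2}"]])
      (use \<open>R > 0\<close> \<open>R0 > 0\<close> \<open>Rs > 0\<close> d in auto)
  \<comment> \<open>Only \<open>\<epsilon> / 2\<close> is granted to \<open>u\<close>; the other
    half is kept for \<open>u0\<close>.\<close>
  with limsup_imp_quadratic_smallness[OF u_limsup, of "\<epsilon> / 2"] \<epsilon>(1) eventually_at_right_less[of 0]
  have "\<forall>\<^sub>F \<rho> in at_right 0. (\<exists>\<sigma>>0. \<forall>t\<in>{0<..<\<sigma>}. \<forall>x\<in>ball 0 \<rho>. norm (u t x) \<le> \<epsilon> / 2 * \<rho>\<^sup>2) \<and>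
      0 < \<rho> \<and> \<rho> < Min {1, R, R0 / 2, d, Rs / 2}"
    by (auto intro: eventually_conj)
  from eventually_happens'[OF trivial_limit_at_right_real this]
  obtain \<rho> where \<rho>_prop: "\<exists>\<sigma>>0. \<forall>t\<in>{0<..<\<sigma>}. \<forall>x\<in>ball 0 \<rho>. norm (u t x) \<le> \<epsilon> / 2 * \<rho>\<^sup>2"
      "0 < \<rho>" "\<rho> < Min {1, R, R0 / 2, d, Rs / 2}" by blast
  then have \<rho>: "0 < \<rho>" "\<rho> < 1" "\<rho> < R" "\<rho> < R0 / 2" "\<rho> < d" "\<rho> < Rs / 2" by simp_all
  obtain \<sigma> where \<sigma>: "0 < \<sigma>"
      and u_small: "\<And>t x. t \<in> {0<..<\<sigma>} \<Longrightarrow> x \<in> ball 0 \<rho> \<Longrightarrow> norm (u t x) \<le> \<epsilon> / 2 * \<rho>\<^sup>2"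
    using \<rho>_prop(1) by blast

  \<comment> \<open>Choice of the time interval\<close>
  define b where "b = Min {\<epsilon> / 2 * \<rho>\<^sup>2 / M, \<kappa> / (K * M), s / (8 * M)}"
  have b: "0 < b" using \<epsilon> \<rho> M \<kappa> K s by (auto simp: b_def)
  have "\<forall>\<^sub>F t in at_right 0. t < Min {T, Ts, \<sigma>, d}"
    by (rule eventually_mono[OF eventually_at_right_real[of 0 "Min {T, Ts, \<sigma>, d}"]])
      (use \<open>T > 0\<close> \<open>Ts > 0\<close> \<sigma> d in auto)
  moreover have "\<forall>\<^sub>F t in at_right 0. \<mu> t < b"
    by (rule order_tendstoD(2)[OF weight_tendsto_0[OF \<open>T0 > 0\<close> weight] b])
  moreover have "\<forall>\<^sub>F t in at_right 0. phi \<mu> t < min (rs * (Rs / 2)) (\<rho> / (4 * L))"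
    by (rule order_tendstoD(2)[OF phi_tendsto_0[OF \<open>T0 > 0\<close> weight]])
       (use \<open>rs > 0\<close> \<open>Rs > 0\<close> \<rho> L in auto)
  ultimately have "\<forall>\<^sub>F t in at_right 0. (\<forall>x\<in>ball 0 R0. norm (\<beta> t x) \<le> C0 * \<mu> t) \<and>
      t < Min {T, Ts, \<sigma>, d} \<and> \<mu> t < b \<and> phi \<mu> t < min (rs * (Rs / 2)) (\<rho> / (4 * L))"
    using C0 by eventually_elim blast
  then obtain t1 where t1: "0 < t1" and small: "\<And>t. 0 < t \<Longrightarrow> t < t1 \<Longrightarrow>
      (\<forall>x\<in>ball 0 R0. norm (\<beta> t x) \<le> C0 * \<mu> t) \<and>
      t < Min {T, Ts, \<sigma>, d} \<and> \<mu> t < b \<and> phi \<mu> t < min (rs * (Rs / 2)) (\<rho> / (4 * L))"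
    unfolding eventually_at_right_field by blast
  have t_less: "t < T" "t < Ts" "t < T0" "t < \<sigma>" "t < d" if "0 < t" "t < t1" for t
    using small[OF that] \<open>Ts \<le> T0\<close> by auto
  have \<beta>_bound: "norm (\<beta> t x) \<le> C0 * \<mu> t" if "0 < t" "t < t1" "norm x < \<rho>" for t x
    using small[OF that(1,2)] that(3) \<rho> \<open>R0 > 0\<close> by auto
  have \<mu>_pos: "0 < \<mu> t" if "0 < t" "t < t1" for t
    using weight_pos[OF \<open>T0 > 0\<close> weight] that t_less[of t] by simp
  \<comment> \<open>In turn: the share of \<open>u0\<close> in the initial bound for the difference,
    its effect on the decay rate, and its share of the Taylor radius \<open>s / 4\<close>.\<close>
  have \<mu>_small: "M * \<mu> t \<le> \<epsilon> / 2 * \<rho>\<^sup>2" "K * (M * \<mu> t) \<le> \<kappa>" "M * \<mu> t \<le> s / 8" if "0 < t" "t < t1" for t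
  proof -
    have "\<mu> t < \<epsilon> / 2 * \<rho>\<^sup>2 / M" "\<mu> t < \<kappa> / (K * M)" "\<mu> t < s / (8 * M)"
      using small[OF that] by (auto simp: b_def)
    then show "M * \<mu> t \<le> \<epsilon> / 2 * \<rho>\<^sup>2" "K * (M * \<mu> t) \<le> \<kappa>" "M * \<mu> t \<le> s / 8"
      using M K by (auto simp: field_simps)
  qed
  \<comment> \<open>The bound \<open>\<rho> / 4\<close> lets \<open>norm x < \<rho> / 4\<close>
    enter the region of radius \<open>\<rho> / 2\<close> on which the difference vanishes; the last
    bound, with \<open>\<rho> < Rs / 2\<close>, places the cylinder inside the domain of
    \<open>u0\<close>.\<close>
  have phi_small: "0 \<le> L * phi \<mu> t" "L * phi \<mu> t < \<rho> / 4" "phi \<mu> t / rs < Rs / 2" if "0 < t" "t < t1" for t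
  proof -
    have "0 \<le> phi \<mu> t" using phi_nonneg[OF \<open>T0 > 0\<close> weight] t_less[OF that] by simp
    then show "0 \<le> L * phi \<mu> t" using L by simp
    show "L * phi \<mu> t < \<rho> / 4" "phi \<mu> t / rs < Rs / 2"
      using small[OF that] L \<open>rs > 0\<close> by (auto simp: field_simps)
  qed

  \<comment> \<open>A common domain for the two solutions\<close>
  define Wp where "Wp = W_region \<mu> Ts Rs rs \<inter> {0<..} \<times> UNIV"
  define Zp where "Zp = {0<..<T} \<times> ball (0::complex) R"
  define Q where "Q = {0<..<t1} \<times> ball (0::complex) \<rho>"
  have QW: "Q \<subseteq> Wp"
  proof
    fix p assume "p \<in> Q"
    then obtain t x where p: "p = (t, x)" "0 < t" "t < t1" "norm x < \<rho>" by (auto simp: Q_def)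
    then have "phi \<mu> t / rs + norm x < Rs"
      using phi_small(3)[OF p(2,3)] \<rho>(6) by linarith
    then show "p \<in> Wp"
      using p t_less(2)[OF p(2,3)] by (simp add: W_region_def Wp_def)
  qed
  have QZ: "Q \<subseteq> Zp" using t_less(1) \<rho>(3) by (auto simp: Q_def Zp_def)
  \<comment> \<open>Being open, \<open>Q\<close> lies in the interiors of both domains, where
    derivatives taken within them are ordinary.\<close>
  have "open Q" unfolding Q_def by (intro open_Times) auto
  then have QWi: "Q \<subseteq> interior Wp" and QZi: "Q \<subseteq> interior Zp"
    using QW QZ by (auto intro: interior_maximal[THEN subsetD])
  have inQ: "(t, x) \<in> Q" if "0 < t" "t < t1" "norm x < \<rho>" for t x
    using that by (simp add: Q_def)
  have in_W: "(t, x) \<in> W_region \<mu> Ts Rs rs" if "0 < t" "t < t1" "norm x < \<rho>" for t x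
    using inQ[OF that] QW by (auto simp: Wp_def)
  have u0_C1: "C1_on Wp u0" and u0_hol: "holomorphic_in_x Wp u0"
    and u0_sol: "solves_E T0 R0 \<rho>0 \<alpha> lam \<beta> c R2 Wp u0"
    using u0 unfolding mu_bounded_solution_def X1_W_def holomorphic_in_x_def Wp_def
    by (auto intro: holomorphic_on_subset)
  have u_C1: "C1_on Zp u" and u_hol: "holomorphic_in_x Zp u"
    using u_X1 unfolding X1_cyl_def Zp_def by auto
  have hol: "u t holomorphic_on ball 0 \<rho>" "u0 t holomorphic_on ball 0 \<rho>" if t: "0 < t" "t < t1" for t
  proof -
    have "(t, 0) \<in> Q" using inQ[OF t] \<rho>(1) by simp
    then have "(t, 0) \<in> interior Zp" "(t, 0) \<in> interior Wp" using QZi QWi by blast+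
    note h = C1_on_has_derivative(2)[OF u_C1 u_hol this(1)] C1_on_has_derivative(2)[OF u0_C1 u0_hol this(2)]
    have "ball 0 \<rho> \<subseteq> {y. (t, y) \<in> Q}" using inQ[OF t] by auto
    then have "ball 0 \<rho> \<subseteq> {y. (t, y) \<in> interior Zp}" "ball 0 \<rho> \<subseteq> {y. (t, y) \<in> interior Wp}"
      using QZi QWi by blast+
    then show "u t holomorphic_on ball 0 \<rho>" "u0 t holomorphic_on ball 0 \<rho>"
      using h holomorphic_on_subset by blast+
  qed

  \<comment> \<open>The transport equation for the difference\<close>
  define w where "w = (\<lambda>t x. u t x - u0 t x)"
  interpret tr: singular_transport w "phi \<mu>" \<mu> t1 \<rho> L K \<kappa> \<eta>
  proof
    show "w t holomorphic_on ball 0 (\<rho> - L * phi \<mu> t)" if "0 < t" "t < t1" for t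
    proof -
      have "w t holomorphic_on ball 0 \<rho>"
        unfolding w_def using hol[OF that] by (intro holomorphic_intros)
      then show ?thesis
        by (rule holomorphic_on_subset) (use phi_small(1)[OF that] in auto)
    qed
    fix t x assume t: "0 < t" "t < t1" and x: "norm x + L * phi \<mu> t < \<rho>"
      and small_w: "norm (w t x) + norm (deriv (w t) x) \<le> \<eta>"
    have x\<rho>: "norm x < \<rho>" using x phi_small(1)[OF t] by simp
    have txZ: "(t, x) \<in> interior Zp" "(t, x) \<in> Zp" and txW: "(t, x) \<in> interior Wp" "(t, x) \<in> Wp"
      using QZi QWi QZ QW inQ[OF t x\<rho>] by blast+
    define ut where "ut = vector_derivative (\<lambda>s. u s x) (at t within {s. (s, x) \<in> Zp})"
    define u0t where "u0t = vector_derivative (\<lambda>s. u0 s x) (at t within {s. (s, x) \<in> Wp})"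
    have wx: "deriv (w t) x = deriv (u t) x - deriv (u0 t) x"
      unfolding w_def using hol[OF t] x\<rho>
      by (intro deriv_diff holomorphic_on_imp_differentiable_at[of _ "ball 0 \<rho>"]) auto
    have wd: "((\<lambda>(t, x). w t x) has_derivative
        (\<lambda>(h, z). of_real h * (ut - u0t) + z * deriv (w t) x)) (at (t, x))"
      using has_derivative_diff[OF C1_on_has_derivative(1)[OF u_C1 u_hol txZ(1)]
          C1_on_has_derivative(1)[OF u0_C1 u0_hol txW(1)]]
      unfolding w_def[symmetric] ut_def[symmetric] u0t_def[symmetric] wx
      by (simp add: w_def case_prod_unfold algebra_simps)
    have uE: "(t, x, u t x, deriv (u t) x) \<in> Omega T0 R0 \<rho>0"
        "of_real t * ut = \<alpha> t x + lam t x * u t x + (\<beta> t x + x * c t x) * deriv (u t) x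
          + R2 t x (u t x) (deriv (u t) x)"
      using u_sol txZ(2) unfolding solves_E_def ut_def Zp_def by blast+
    have u0E: "of_real t * u0t = \<alpha> t x + lam t x * u0 t x + (\<beta> t x + x * c t x) * deriv (u0 t) x
          + R2 t x (u0 t x) (deriv (u0 t) x)"
      using u0_sol txW(2) unfolding solves_E_def u0t_def by blast
    have tT0: "t \<in> {0..T0}" and xR0: "x \<in> ball 0 R0" using uE(1) by (auto simp: Omega_def)
    define n where "n = norm (w t x) + norm (deriv (w t) x)"
    \<comment> \<open>No bound on the derivative of \<open>u\<close> is given directly: it is
      controlled through the difference, by \<open>n\<close>, and through \<open>u0\<close>, by
      \<open>M * \<mu> t\<close>.\<close>
    define m where "m = n + M * \<mu> t"
    have ub: "norm (u0 t x) \<le> M * \<mu> t" "norm (deriv (u0 t) x) \<le> M * \<mu> t"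
      using u0_bound[OF in_W[OF t x\<rho>] t(1)] by auto
    have um: "norm (u t x) \<le> m" "norm (deriv (u t) x) \<le> m" "norm (u0 t x) \<le> m" "norm (deriv (u0 t) x) \<le> m"
      using ub norm_triangle_sub[of "u t x" "u0 t x"] norm_triangle_sub[of "deriv (u t) x" "deriv (u0 t) x"]
        norm_ge_zero[of "w t x"] norm_ge_zero[of "deriv (w t) x"]
      unfolding m_def n_def wx unfolding w_def by linarith+
    have ms: "m \<le> s / 4" using small_w \<eta>(2) \<mu>_small(3)[OF t] by (simp add: m_def n_def)
    have taylor_t: "((\<lambda>(i, j). a i j t x * p ^ i * q ^ j) has_sum R2 t x p q) {(i, j). 2 \<le> i + j}"
      if "p \<in> ball 0 \<rho>0" "q \<in> ball 0 \<rho>0" for p q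
      by (rule R2_taylor) (use that tT0 xR0 in \<open>auto simp: Omega_def\<close>)
    have N_t: "norm (R2 t x p q) \<le> N" if "norm p \<le> s" "norm q \<le> s" for p q
      using N[OF tT0 _ that] x\<rho> \<rho>(4) by simp
    obtain A B where AB: "R2 t x (u t x) (deriv (u t) x) - R2 t x (u0 t x) (deriv (u0 t) x)
          = A * (u t x - u0 t x) + B * (deriv (u t) x - deriv (u0 t) x)"
        "norm A \<le> K * m" "norm B \<le> K * m"
      unfolding K_def
      by (rule taylor_difference[OF R2_hol[OF tT0] xR0 taylor_t s N_t um ms])
    have Km: "K * m = K * n + K * (M * \<mu> t)" by (simp add: m_def algebra_simps)
    show "\<exists>wt l c' e.
      ((\<lambda>(t, x). w t x) has_derivative (\<lambda>(h, z). of_real h * wt + z * deriv (w t) x)) (at (t, x)) \<and>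
      of_real t * wt = l * w t x + (e + x * c') * deriv (w t) x \<and> Re c' \<le> 0 \<and>
      Re l \<le> - 2 * \<kappa> + K * (norm (w t x) + norm (deriv (w t) x)) \<and>
      norm e < L * \<mu> t + K * (norm (w t x) + norm (deriv (w t) x))"
    \<comment> \<open>In the difference of the two equations \<open>\<alpha>\<close> cancels,
      \<open>A\<close> joins \<open>lam\<close> and \<open>B\<close> joins \<open>\<beta>\<close>,
      while \<open>c\<close> keeps its sign.\<close>
    proof (intro exI conjI)
      show "of_real t * (ut - u0t) = (lam t x + A) * w t x + ((\<beta> t x + B) + x * c t x) * deriv (w t) x"
        using uE(2) u0E AB(1) unfolding wx unfolding w_def by algebra
      show "Re (c t x) \<le> 0" by (rule Re_c[OF tT0 xR0])
      have "Re A \<le> K * n + \<kappa>"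
        using complex_Re_le_cmod[of A] AB(2) Km \<mu>_small(2)[OF t] by linarith
      moreover have "Re (lam t x) \<le> - 3 * \<kappa>"
        using lam_bound[OF tT0 xR0] t_less[OF t] x\<rho> \<rho> by simp
      ultimately show "Re (lam t x + A) \<le> - 2 * \<kappa> + K * (norm (w t x) + norm (deriv (w t) x))"
        by (simp add: n_def)
      have "norm (\<beta> t x + B) \<le> C0 * \<mu> t + K * m"
        using norm_triangle_ineq[of "\<beta> t x" B] \<beta>_bound[OF t x\<rho>] AB(3) by linarith
      also have "\<dots> \<le> \<bar>C0\<bar> * \<mu> t + K * m"
        using \<mu>_pos[OF t] by (intro add_right_mono mult_right_mono) auto
      also have "\<dots> < L * \<mu> t + K * n"
        using \<mu>_pos[OF t] unfolding Km L_def by (simp add: algebra_simps)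
      finally show "norm (\<beta> t x + B) < L * \<mu> t + K * (norm (w t x) + norm (deriv (w t) x))"
        by (simp add: n_def)
    qed (rule wd)
  qed (use \<kappa> K \<rho> phi_has_derivative[OF \<open>T0 > 0\<close> weight] t_less in auto)

  \<comment> \<open>Vanishing of the difference near the origin\<close>
  have "w t x = 0" if "t \<in> {0<..<t1}" "x \<in> ball 0 (\<rho> / 4)" for t x
  proof (rule tr.vanishes[where S = "\<epsilon> * \<rho>\<^sup>2", OF _ _ refl])
    show "norm (w t x) \<le> \<epsilon> * \<rho>\<^sup>2" if t: "0 < t" "t < t1" and x: "norm x + L * phi \<mu> t < \<rho>" for t x
    proof -
      have x\<rho>: "norm x < \<rho>" using x phi_small(1)[OF t] by simp
      have "norm (u t x) \<le> \<epsilon> / 2 * \<rho>\<^sup>2" using u_small t t_less[OF t] x\<rho> by simp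
      moreover have "norm (u0 t x) \<le> \<epsilon> / 2 * \<rho>\<^sup>2"
        using in_W[OF t x\<rho>] u0_bound[of t x] t \<mu>_small(1)[OF t] by force
      ultimately show ?thesis
        unfolding w_def using norm_triangle_ineq4[of "u t x" "u0 t x"] by simp
    qed
    \<comment> \<open>Since \<open>S\<close> is quadratic in \<open>\<rho>\<close>, division by
      \<open>\<rho>\<close> still leaves a quantity linear in \<open>\<rho>\<close> with a factor
      proportional to \<open>\<epsilon>\<close>, comparable with the available room
      \<open>\<rho> / 8\<close>.\<close>
    have "\<epsilon> * \<rho>\<^sup>2 + 16 * (\<epsilon> * \<rho>\<^sup>2) / \<rho> \<le> 17 * \<epsilon> * \<rho>" (is "?N \<le> _")
      using \<epsilon>(1) \<rho>(1,2) by (simp add: power2_eq_square)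
    then have N_le: "?N \<le> 17 * \<epsilon> * \<rho>" .
    also have "\<dots> \<le> 17 * \<epsilon>" using \<epsilon>(1) \<rho>(1,2) by (simp add: mult_left_le)
    finally show N\<eta>: "?N \<le> \<eta>" using \<epsilon>(2) by simp
    have "K * ?N \<le> K * \<eta>" by (rule mult_left_mono[OF N\<eta>]) (use K in simp)
    then show "K * ?N < \<kappa>" using \<eta>(3) by linarith
    have "K * ?N * ln 4 / \<kappa> \<le> K * (17 * \<epsilon> * \<rho>) * ln 4 / \<kappa>"
      using N_le K \<kappa> by (intro divide_right_mono mult_right_mono mult_left_mono) auto
    also have "\<dots> = (136 * K * ln 4 * \<epsilon>) / \<kappa> * (\<rho> / 8)" by simp
    also have "\<dots> \<le> 1 * (\<rho> / 8)" using \<epsilon>(3) \<kappa> \<rho>(1) by (intro mult_right_mono) auto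
    finally show "K * ?N * ln 4 / \<kappa> \<le> \<rho> / 8" by simp
    show "norm x + L * phi \<mu> t < \<rho> / 2" using that phi_small(2)[of t] by simp
  qed (use that \<epsilon>(1) in auto)
  moreover have "{0<..<t1} \<times> ball 0 (\<rho> / 4) \<subseteq> ({0<..<T} \<times> ball 0 R) \<inter> W_region \<mu> Ts Rs rs"
    using t_less(1) in_W \<rho>(1,3) by auto
  ultimately show ?thesis
    using t1 \<rho>(1) by (intro exI[of _ t1] exI[of _ "\<rho> / 4"] conjI) (auto simp: w_def)
qed

end
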